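(* Let $f:\mathbb R\to\mathbb R$ be a strictly positive, continuous, even, $2\pi$-periodic function. There exist a countable-state, irreducible, aperiodic, positive recurrent Markov chain with stationary distribution $\pi$ and a function $h\in L^2(\pi)$ with $\pi(h)=0$ such that $$\gamma_k:=\mathbb E_\pi[h(X_0)h(X_k)]=\frac12\,\widehat f(k),\qquad k\ge0.$$
   Context: $\widehat f(k)=\frac1{2\pi}\int_{-\pi}^{\pi}f(\theta)e^{-ik\theta}\,d\theta$. $(X_n)_{n\ge0}$ is the stationary version of the chain ($X_0\sim\pi$), and $\mathbb E_\pi$ is expectation under it. *)

theory Defs
  imports "HOL-Probability.Probability"
begin

text \<open>
  A Markov chain is given by a nonempty state space \<open>S\<close> and a transition kernel
  \<open>K\<close>, where \<open>pmf (K x) y\<close> is the probability of a step from \<open>x\<close> to \<open>y\<close>. The kernel is a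
  total function, but only its values on the closed set \<open>S\<close> matter.
\<close>

definition markov_kernel :: "'s set \<Rightarrow> ('s \<Rightarrow> 's pmf) \<Rightarrow> bool" where
  "markov_kernel S K \<longleftrightarrow> S \<noteq> {} \<and> (\<forall>x\<in>S. set_pmf (K x) \<subseteq> S)"

definition nstep :: "('s \<Rightarrow> 's pmf) \<Rightarrow> nat \<Rightarrow> 's \<Rightarrow> 's pmf" where
  "nstep K n x = ((\<lambda>\<mu>. bind_pmf \<mu> K) ^^ n) (return_pmf x)"

definition irreducible_chain :: "'s set \<Rightarrow> ('s \<Rightarrow> 's pmf) \<Rightarrow> bool" where
  "irreducible_chain S K \<longleftrightarrow> (\<forall>x\<in>S. \<forall>y\<in>S. \<exists>n. 0 < pmf (nstep K n x) y)"

definition aperiodic_chain :: "'s set \<Rightarrow> ('s \<Rightarrow> 's pmf) \<Rightarrow> bool" where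
  "aperiodic_chain S K \<longleftrightarrow> (\<forall>x\<in>S. Gcd {n::nat. 0 < n \<and> 0 < pmf (nstep K n x) x} = 1)"

text \<open>
  The law of the whole trajectory \<open>(X\<^sub>n)\<close> of the chain with initial distribution \<open>\<mu>\<close>,
  as a measure on sequences; \<open>X\<^sub>n\<close> is the coordinate map \<open>\<lambda>\<omega>. \<omega> n\<close>.
  It is the Ionescu-Tulcea limit of the one-step kernels; lemma \<open>emeasure_path_law\<close>
  gives its finite-dimensional distributions.
\<close>

definition chain_step :: "'s pmf \<Rightarrow> ('s \<Rightarrow> 's pmf) \<Rightarrow> nat \<Rightarrow> (nat \<Rightarrow> 's) \<Rightarrow> 's measure" where
  "chain_step \<mu> K i \<omega> = measure_pmf (if i = 0 then \<mu> else K (\<omega> (i - 1)))"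

definition path_law :: "'s pmf \<Rightarrow> ('s \<Rightarrow> 's pmf) \<Rightarrow> (nat \<Rightarrow> 's) measure" where
  "path_law \<mu> K = projective_family.lim UNIV
     (Ionescu_Tulcea.CI (chain_step \<mu> K) (\<lambda>_. count_space UNIV)) (\<lambda>_. count_space UNIV)"

text \<open>The infimum of the empty set is \<open>\<infinity>\<close>: the path never returns.\<close>

definition return_time :: "'s \<Rightarrow> (nat \<Rightarrow> 's) \<Rightarrow> enat" where
  "return_time x \<omega> = (INF n\<in>{n. 0 < n \<and> \<omega> n = x}. enat n)"

definition positive_recurrent_chain :: "'s set \<Rightarrow> ('s \<Rightarrow> 's pmf) \<Rightarrow> bool" where
  "positive_recurrent_chain S K \<longleftrightarrow>
     (\<forall>x\<in>S. (\<integral>\<^sup>+ \<omega>. ennreal_of_enat (return_time x \<omega>) \<partial>path_law (return_pmf x) K) < \<infinity>)"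

definition stationary_distribution :: "'s set \<Rightarrow> ('s \<Rightarrow> 's pmf) \<Rightarrow> 's pmf \<Rightarrow> bool" where
  "stationary_distribution S K \<pi> \<longleftrightarrow> set_pmf \<pi> \<subseteq> S \<and> bind_pmf \<pi> K = \<pi>"

definition fourier_coeff :: "(real \<Rightarrow> real) \<Rightarrow> int \<Rightarrow> complex" where
  "fourier_coeff f k = complex_of_real (1 / (2 * pi)) *
     integral {-pi..pi} (\<lambda>\<theta>. complex_of_real (f \<theta>) * exp (- \<i> * of_int k * complex_of_real \<theta>))"

lemma Ionescu_Tulcea_chain_step: "Ionescu_Tulcea (chain_step \<mu> K) (\<lambda>_. count_space UNIV)"
proof (rule Ionescu_Tulcea.intro)
  show "chain_step \<mu> K i \<in> measurable (PiM {0..<i} (\<lambda>_. count_space UNIV))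
          (subprob_algebra (count_space UNIV))" for i
  proof (cases "i = 0")
    case True
    then show ?thesis
      by (simp add: chain_step_def[abs_def] measure_pmf_in_subprob_algebra)
  next
    case False
    have "(\<lambda>\<omega>. measure_pmf (K (\<omega> (i - 1)))) \<in> measurable
        (PiM {0..<i} (\<lambda>_. count_space UNIV)) (subprob_algebra (count_space UNIV))"
      by (rule measurable_compose[OF measurable_component_singleton[of "i - 1"]])
         (use False in \<open>auto simp: measure_pmf_in_subprob_algebra\<close>)
    with False show ?thesis
      by (simp add: chain_step_def[abs_def])
  qed
qed (unfold chain_step_def, rule prob_space_measure_pmf)

lemma prob_space_path_law: "prob_space (path_law \<mu> K)"
proof -
  interpret Ionescu_Tulcea "chain_step \<mu> K" "\<lambda>_. count_space UNIV"
    by (rule Ionescu_Tulcea_chain_step)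
  have "emeasure PF.lim (PF.emb UNIV {} {\<lambda>_. undefined}) = emeasure (CI {}) {\<lambda>_. undefined}"
    by (rule lim) (auto simp: PiM_empty)
  also have "\<dots> = 1"
    using prob_space.emeasure_space_1[OF PF.prob_space_P[of "{}"]] by (simp add: PF.space_P PiM_empty space_PiM)
  also have "PF.emb UNIV {} {\<lambda>_. undefined} = UNIV"
    by (auto simp: prod_emb_def space_PiM restrict_def)
  finally show ?thesis
    by (intro prob_spaceI)
       (simp add: path_law_def PF.space_lim space_PiM)
qed

lemma sets_path_law: "sets (path_law \<mu> K) = sets (PiM UNIV (\<lambda>_. count_space UNIV))"
proof -
  interpret Ionescu_Tulcea "chain_step \<mu> K" "\<lambda>_. count_space UNIV"
    by (rule Ionescu_Tulcea_chain_step)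
  show ?thesis by (simp add: path_law_def)
qed

lemma emeasure_path_law:
  "emeasure (path_law \<mu> K) {\<omega>. \<forall>i\<le>n. \<omega> i = x i} =
     ennreal (pmf \<mu> (x 0) * (\<Prod>i<n. pmf (K (x i)) (x (Suc i))))"
proof -
  interpret Ionescu_Tulcea "chain_step \<mu> K" "\<lambda>_. count_space UNIV"
    by (rule Ionescu_Tulcea_chain_step)
  let ?M = "\<lambda>_::nat. count_space (UNIV :: 'a set)"
  let ?A = "\<lambda>n. PiE {0..<Suc n} (\<lambda>i. {x i})"
  have A: "?A n \<in> sets (PiM {0..<Suc n} ?M)" for n
    by (intro sets_PiM_I_finite) auto
  have eP: "emeasure (eP n \<omega>) (?A n) =
      indicator (PiE {0..<n} (\<lambda>i. {x i})) \<omega> * ennreal (pmf (if n = 0 then \<mu> else K (x (n - 1))) (x n))"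
    if w: "\<omega> \<in> space (PiM {0..<n} ?M)" for n \<omega>
  proof -
    have "(\<lambda>y. fun_upd \<omega> n y) -` ?A n = (if \<omega> \<in> PiE {0..<n} (\<lambda>i. {x i}) then {x n} else {})"
      using w by (auto simp: space_PiM PiE_iff extensional_def less_Suc_eq split: if_splits)
    then show ?thesis
      by (subst emeasure_eP[OF w A])
         (auto simp: chain_step_def emeasure_pmf_single PiE_iff split: split_indicator)
  qed
  have "emeasure (C 0 (Suc n) (\<lambda>_. undefined)) (?A n) =
      ennreal (pmf \<mu> (x 0) * (\<Prod>i<n. pmf (K (x i)) (x (Suc i))))" for n
  proof (induction n)
    case 0
    show ?case
      using eP[of "\<lambda>_. undefined" 0] measurable_eP[of 0]
      by (simp add: bind_return[where N = "PiM {0..<Suc 0} ?M"] space_PiM split: split_indicator)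
  next
    case (Suc n)
    have s: "space (C 0 (Suc n) (\<lambda>_. undefined)) = space (PiM {0..<Suc n} ?M)"
      using space_C[of "\<lambda>_. undefined" 0 "Suc n"] by (simp add: space_PiM)
    have ss: "sets (C 0 (Suc n) (\<lambda>_. undefined)) = sets (PiM {0..<Suc n} ?M)"
      using sets_C[of "\<lambda>_. undefined" 0 "Suc n"] by (simp add: space_PiM)
    have m: "eP (Suc n) \<in> measurable (C 0 (Suc n) (\<lambda>_. undefined)) (subprob_algebra (PiM {0..<Suc (Suc n)} ?M))"
      using measurable_eP[of "Suc n"] measurable_cong_sets[OF ss refl] by blast
    have "emeasure (C 0 (Suc (Suc n)) (\<lambda>_. undefined)) (?A (Suc n)) =
        (\<integral>\<^sup>+\<omega>. emeasure (eP (Suc n) \<omega>) (?A (Suc n)) \<partial>C 0 (Suc n) (\<lambda>_. undefined))"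
      unfolding C.simps(2)[of 0 "Suc n"] add_0
      by (rule emeasure_bind[OF _ m A]) (simp add: s space_PiM PiE_eq_empty_iff del: C.simps)
    also have "\<dots> = (\<integral>\<^sup>+\<omega>. indicator (?A n) \<omega> * ennreal (pmf (K (x n)) (x (Suc n))) \<partial>C 0 (Suc n) (\<lambda>_. undefined))"
      by (rule nn_integral_cong) (simp add: s eP del: C.simps)
    also have "\<dots> = emeasure (C 0 (Suc n) (\<lambda>_. undefined)) (?A n) * ennreal (pmf (K (x n)) (x (Suc n)))"
      using A[of n, folded ss] by (simp add: nn_integral_multc borel_measurable_indicator del: C.simps)
    finally show ?case
      unfolding Suc.IH by (simp add: ennreal_mult''[symmetric] mult.assoc del: C.simps)
  qed
  moreover have "{\<omega>. \<forall>i\<le>n. \<omega> i = x i} = PF.emb UNIV {0..<Suc n} (?A n)"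
    by (auto simp: prod_emb_def PiE_iff space_PiM less_Suc_eq_le)
  moreover have "emeasure PF.lim (PF.emb UNIV {0..<Suc n} (?A n)) = emeasure (C 0 (Suc n) (\<lambda>_. undefined)) (?A n)"
    using A[of n] sets.sets_into_space[OF A[of n]]
    by (subst lim) (auto simp: emeasure_CI[of _ "Suc n"] simp del: C.simps intro!: arg_cong2[where f=emeasure] simp: prod_emb_id space_PiM)
  ultimately show ?thesis
    by (simp add: path_law_def del: C.simps)
qed

end

theory Submission
  imports Defs
begin

text \<open>
  The idea is to write \<open>f / 2\<close> as a sum of squared moduli of polynomials on the unit circle
  and to let the chain run through the coefficient sequences of these polynomials.

  Consider a chain that traverses finite blocks one after the other, where each new block is
  drawn independently of the past and carries a fair random sign. Let \<open>h\<close> be the sign times a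
  sequence of numbers attached to the block. The signs make the covariance between different
  blocks vanish (\<open>block_autocovariance\<close>), so \<open>\<gamma>\<^sub>k\<close> is a weighted sum over the blocks of the
  autocorrelations \<open>\<Sum>m. p m * p (m + k)\<close> of the attached sequences \<open>p\<close>. These are the Fourier
  coefficients of \<open>\<bar>\<Sum>m. p m * z ^ m\<bar>\<^sup>2\<close>. The weights of the blocks are at our disposal, since they can be
  absorbed into the scaling of the sequences: taking the block length minus one geometric
  makes the stationary law a product measure, in which the elapsed and the remaining time in the block are
  independent geometric variables (\<open>block_stationary_invariant\<close>).

  For the decomposition of \<open>f / 2\<close>, put \<open>t = (1 - cos \<theta>) / 2\<close>. A positive continuous function of
  \<open>t \<in> [0, 1]\<close> is the uniform limit of sums of Bernstein monomials \<open>t ^ a * (1 - t) ^ b\<close> with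
  nonnegative coefficients: subtract half of a good Bernstein approximation, which leaves a
  positive function smaller by a fixed factor, and iterate
  (\<open>positive_function_bernstein_series\<close>). On the unit circle such a monomial is a multiple of
  \<open>\<bar>(1 - z) ^ a * (1 + z) ^ b\<bar>\<^sup>2\<close>, which gives \<open>fourier_coeff_block_sums\<close>.

  Irreducibility and aperiodicity are read off from the blocks, and positive recurrence
  follows from the existence of a stationary law with full support by Kac's inequality
  (\<open>kac_inequality\<close>). Square integrability of \<open>h\<close> is the case \<open>k = 0\<close>, where all terms are
  nonnegative and the sum is the finite number \<open>\<gamma>\<^sub>0\<close>.
\<close>

section \<open>Greedy expansion of a positive function in Bernstein monomials\<close>

definition bernstein_approx :: "nat \<Rightarrow> (real \<Rightarrow> real) \<Rightarrow> real \<Rightarrow> real" where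
  "bernstein_approx n r t = (\<Sum>a\<le>n. r (real a / real n) * Bernstein n a t)"

text \<open>
  The test keeps the Bernstein polynomial of the remainder only if it is within a factor
  between \<open>1/2\<close> and \<open>3/2\<close> of the remainder. Subtracting half of it then leaves between
  \<open>1/4\<close> and \<open>3/4\<close> of the remainder, so that positivity survives and the remainder shrinks
  by a fixed factor. If the test fails, the degree \<open>n\<close> is skipped; thus every degree
  occurs at most once and the series is indexed by the degree itself.
\<close>
definition step_weight :: "(real \<Rightarrow> real) \<Rightarrow> nat \<Rightarrow> real" where
  "step_weight r n = (if \<forall>t\<in>{0..1}. r t / 2 \<le> bernstein_approx n r t \<and> bernstein_approx n r t \<le> 3 / 2 * r t
     then 1 / 2 else 0)"

fun remainder :: "(real \<Rightarrow> real) \<Rightarrow> nat \<Rightarrow> real \<Rightarrow> real" where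
  "remainder g 0 t = g t"
| "remainder g (Suc n) t =
     remainder g n t - step_weight (remainder g n) n * bernstein_approx n (remainder g n) t"

lemma remainder_Suc_cases:
  assumes "t \<in> {0..1}"
  obtains "step_weight (remainder g n) n = 0" and "remainder g (Suc n) t = remainder g n t"
  | "step_weight (remainder g n) n = 1 / 2"
    and "remainder g n t / 4 \<le> remainder g (Suc n) t" and "remainder g (Suc n) t \<le> 3 / 4 * remainder g n t"
proof (cases "step_weight (remainder g n) n = 0")
  case False
  then have sw: "step_weight (remainder g n) n = 1 / 2"
    and b: "remainder g n t / 2 \<le> bernstein_approx n (remainder g n) t"
      "bernstein_approx n (remainder g n) t \<le> 3 / 2 * remainder g n t"
    using assms by (auto simp: step_weight_def split: if_splits)
  have "remainder g (Suc n) t = remainder g n t - bernstein_approx n (remainder g n) t / 2"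
    using sw by simp
  with b have "remainder g n t / 4 \<le> remainder g (Suc n) t" "remainder g (Suc n) t \<le> 3 / 4 * remainder g n t"
    by linarith+
  with sw show ?thesis
    by (rule that(2))
qed (use that(1) in simp)

lemma continuous_on_remainder:
  assumes "continuous_on {0..1} g"
  shows "continuous_on {0..1} (remainder g n)"
proof (induction n)
  case (Suc n)
  have "continuous_on {0..1} (\<lambda>t. remainder g n t - step_weight (remainder g n) n * bernstein_approx n (remainder g n) t)"
    unfolding bernstein_approx_def Bernstein_def by (intro continuous_intros Suc)
  then show ?case
    by simp
qed (use assms in simp)

lemma remainder_pos:
  assumes "\<forall>t\<in>{0..1}. 0 < g t" and t: "t \<in> {0..1}"
  shows "0 < remainder g n t"
proof (induction n)
  case (Suc n)
  from t show ?case
    by (rule remainder_Suc_cases[of t g n]) (use Suc in linarith)+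
qed (use assms in simp)

lemma remainder_Suc_le:
  assumes "\<forall>t\<in>{0..1}. 0 < g t" and t: "t \<in> {0..1}"
  shows "remainder g (Suc n) t \<le> remainder g n t"
proof -
  have "0 < remainder g n t"
    using assms by (rule remainder_pos)
  with t show ?thesis
    by (rule_tac remainder_Suc_cases[of t g n]) linarith+
qed

lemma remainder_antimono:
  assumes "\<forall>t\<in>{0..1}. 0 < g t" and "t \<in> {0..1}" and "m \<le> n"
  shows "remainder g n t \<le> remainder g m t"
  using assms(3) remainder_Suc_le[OF assms(1,2)]
  by (rule lift_Suc_antimono_le[of "\<lambda>n. remainder g n t", rotated]) 

text \<open>
  If every degree from \<open>n\<close> on were skipped, the remainder would stay equal to one fixed
  positive continuous function; but its Bernstein polynomials converge to it uniformly and
  hence pass the test for a large degree.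
\<close>
lemma remainder_eventually_shrinks:
  assumes pos: "\<forall>t\<in>{0..1}. 0 < g t" and cont: "continuous_on {0..1} g"
  shows "\<exists>m. \<forall>t\<in>{0..1}. remainder g m t \<le> 3 / 4 * remainder g n t"
proof -
  have "\<exists>j\<ge>n. step_weight (remainder g j) j \<noteq> 0"
  proof (rule ccontr)
    assume "\<not> (\<exists>j\<ge>n. step_weight (remainder g j) j \<noteq> 0)"
    then have zero: "step_weight (remainder g j) j = 0" if "n \<le> j" for j
      using that by blast
    let ?r = "remainder g n"
    have const: "remainder g j = ?r" if "n \<le> j" for j
      using that
    proof (induction rule: dec_induct)
      case (step j)
      have "remainder g (Suc j) = remainder g j"
        using zero[OF step(1)] by (intro ext) simp
      with step show ?case
        by metis
    qed simp
    obtain s where s: "s \<in> {0..1}" "\<And>t. t \<in> {0..1} \<Longrightarrow> ?r s \<le> ?r t"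
      using continuous_attains_inf[OF compact_Icc _ continuous_on_remainder[OF cont], of n]
      by fastforce
    have "0 < ?r s / 2"
      using remainder_pos[OF pos s(1)] by simp
    then obtain N where N: "\<And>j t. N \<le> j \<Longrightarrow> t \<in> {0..1} \<Longrightarrow> \<bar>?r t - bernstein_approx j ?r t\<bar> < ?r s / 2"
      using Bernstein_Weierstrass[OF continuous_on_remainder[OF cont], of "?r s / 2" n]
      unfolding bernstein_approx_def by blast
    have "?r t / 2 \<le> bernstein_approx (max N n) ?r t \<and> bernstein_approx (max N n) ?r t \<le> 3 / 2 * ?r t"
      if "t \<in> {0..1}" for t
      using N[OF max.cobounded1[of N n] that] s(2)[OF that] unfolding abs_less_iff by linarith
    then have "step_weight ?r (max N n) = 1 / 2"
      unfolding step_weight_def by (intro if_P) blast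
    with zero[of "max N n", unfolded const[OF max.cobounded2]] show False
      by simp
  qed
  then obtain j where j: "n \<le> j" "step_weight (remainder g j) j \<noteq> 0"
    by blast
  have "remainder g (Suc j) t \<le> 3 / 4 * remainder g j t" if "t \<in> {0..1}" for t
    by (rule remainder_Suc_cases[OF that, of g j]) (use j(2) in simp_all)
  then have "remainder g (Suc j) t \<le> 3 / 4 * remainder g n t" if "t \<in> {0..1}" for t
    using remainder_antimono[OF pos that j(1)] that by fastforce
  then show ?thesis
    by blast
qed

lemma remainder_geometric:
  assumes "\<forall>t\<in>{0..1}. 0 < g t" and "continuous_on {0..1} g"
  shows "\<exists>m. \<forall>t\<in>{0..1}. remainder g m t \<le> (3 / 4) ^ j * g t"
proof (induction j)
  case 0
  show ?case by (rule exI[of _ 0]) simp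
next
  case (Suc j)
  then obtain n where n: "\<forall>t\<in>{0..1}. remainder g n t \<le> (3 / 4) ^ j * g t"
    by blast
  obtain m where m: "\<forall>t\<in>{0..1}. remainder g m t \<le> 3 / 4 * remainder g n t"
    using remainder_eventually_shrinks[OF assms] by blast
  have "remainder g m t \<le> (3 / 4) ^ Suc j * g t" if "t \<in> {0..1}" for t
    using n m that by fastforce
  then show ?case
    by blast
qed

lemma uniform_limit_remainder:
  assumes pos: "\<forall>t\<in>{0..1}. 0 < g t" and cont: "continuous_on {0..1} g"
  shows "uniform_limit {0..1} (remainder g) (\<lambda>_. 0) sequentially"
proof (rule uniform_limitI)
  fix e :: real assume e: "0 < e"
  obtain M where M: "\<forall>t\<in>{0..1}. g t \<le> M"
    using continuous_attains_sup[OF compact_Icc _ cont] by force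
  have "0 < M"
    using M pos by force
  obtain j where "(3 / 4) ^ j < e / M"
    using real_arch_pow_inv[of "e / M" "3 / 4"] e \<open>0 < M\<close> by auto
  then have j: "(3 / 4) ^ j * M < e"
    using \<open>0 < M\<close> by (simp add: field_simps)
  obtain m where m: "\<forall>t\<in>{0..1}. remainder g m t \<le> (3 / 4) ^ j * g t"
    using remainder_geometric[OF assms] by blast
  have "dist (remainder g n t) 0 < e" if "m \<le> n" "t \<in> {0..1}" for n t
  proof -
    have "remainder g n t \<le> remainder g m t"
      using remainder_antimono[OF pos] that by blast
    also have "\<dots> \<le> (3 / 4) ^ j * g t"
      using m that by blast
    also have "\<dots> \<le> (3 / 4) ^ j * M"
      using M that by (intro mult_left_mono) auto
    finally show ?thesis
      using remainder_pos[OF pos that(2)] j by (simp add: abs_of_pos)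
  qed
  then show "\<forall>\<^sub>F n in sequentially. \<forall>t\<in>{0..1}. dist (remainder g n t) 0 < e"
    unfolding eventually_sequentially by blast
qed

text \<open>
  A greedy form of Bernstein's theorem in which all terms are nonnegative. The coefficients
  are values of the positive remainders, so nonnegativity costs nothing, and the part of
  \<open>g\<close> not yet represented tends to zero uniformly.
\<close>
theorem positive_function_bernstein_series:
  fixes g :: "real \<Rightarrow> real"
  assumes pos: "\<forall>t\<in>{0..1}. 0 < g t" and cont: "continuous_on {0..1} g"
  shows "\<exists>c :: nat \<Rightarrow> nat \<Rightarrow> real. (\<forall>i. \<forall>a\<le>i. 0 \<le> c i a) \<and>
    uniform_limit {0..1} (\<lambda>N t. \<Sum>i<N. \<Sum>a\<le>i. c i a * (t ^ a * (1 - t) ^ (i - a))) g sequentially"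
proof (intro exI conjI allI impI)
  let ?c = "\<lambda>i a. step_weight (remainder g i) i * remainder g i (real a / real i) * real (i choose a)"
  show "0 \<le> ?c i a" if "a \<le> i" for i a
  proof -
    have "real a / real i \<in> {0..1}"
      using that by (auto simp: divide_le_eq)
    then have "0 < remainder g i (real a / real i)"
      using remainder_pos[OF pos] by blast
    then show ?thesis
      by (simp add: step_weight_def)
  qed
  have "(\<Sum>i<N. \<Sum>a\<le>i. ?c i a * (t ^ a * (1 - t) ^ (i - a))) = g t - remainder g N t" for N t
    by (induction N) (simp_all add: bernstein_approx_def Bernstein_def sum_distrib_left mult_ac)
  moreover have "uniform_limit {0..1} (\<lambda>N t. g t - remainder g N t) (\<lambda>t. g t - 0) sequentially"
    by (intro uniform_limit_minus uniform_limit_const uniform_limit_remainder[OF assms])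
  ultimately show "uniform_limit {0..1} (\<lambda>N t. \<Sum>i<N. \<Sum>a\<le>i. ?c i a * (t ^ a * (1 - t) ^ (i - a))) g sequentially"
    by simp
qed

section \<open>Fourier coefficients of squared moduli of polynomials\<close>

lemma map_poly_of_real_mult:
  "map_poly complex_of_real (p * q) = map_poly of_real p * map_poly of_real q"
  by (intro poly_eqI) (simp_all add: coeff_map_poly coeff_mult)

text \<open>
  On the unit circle \<open>\<bar>1 - z\<bar>\<^sup>2 = 4 t\<close> and \<open>\<bar>1 + z\<bar>\<^sup>2 = 4 (1 - t)\<close> for
  \<open>z = cis \<theta>\<close> and \<open>t = (1 - cos \<theta>) / 2\<close>. So the Bernstein monomial
  \<open>t ^ a * (1 - t) ^ b\<close> is, up to the factor \<open>4 ^ (a + b)\<close>, the squared modulus of this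
  polynomial with real coefficients. This replaces the Fejer-Riesz factorisation.
\<close>
definition two_root_poly :: "nat \<Rightarrow> nat \<Rightarrow> real poly" where
  "two_root_poly a b = [:1, - 1:] ^ a * [:1, 1:] ^ b"

lemma two_root_poly_eval:
  assumes "a + b \<le> i"
  shows "(\<Sum>m\<le>i. complex_of_real (coeff (two_root_poly a b) m) * z ^ m) = (1 - z) ^ a * (1 + z) ^ b"
proof -
  have lin: "poly (map_poly complex_of_real ([:1, c:] ^ n)) z = (1 + of_real c * z) ^ n" for c n
    by (induction n) (simp_all add: map_poly_of_real_mult map_poly_pCons mult.commute del: mult_pCons_left)
  have "degree (two_root_poly a b) \<le> i"
    using degree_mult_le[of "[:1, - 1:] ^ a" "[:1, 1:] ^ b :: real poly"]
      degree_power_le[of "[:1, - 1:] :: real poly" a] degree_power_le[of "[:1, 1:] :: real poly" b] assms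
    by (simp add: two_root_poly_def)
  then have "(\<Sum>m\<le>i. complex_of_real (coeff (two_root_poly a b) m) * z ^ m) =
      poly (map_poly complex_of_real (two_root_poly a b)) z"
    by (auto simp: poly_altdef degree_map_poly coeff_map_poly intro: le_degree intro!: sum.mono_neutral_right)
  also have "\<dots> = (1 - z) ^ a * (1 + z) ^ b"
    unfolding two_root_poly_def map_poly_of_real_mult poly_mult lin by simp
  finally show ?thesis .
qed

lemma has_integral_exp_period:
  "((\<lambda>\<theta>. exp (\<i> * of_int n * complex_of_real \<theta>)) has_integral (if n = 0 then 2 * of_real pi else 0)) {- pi..pi}"
proof (cases "n = 0")
  case True
  then show ?thesis
    using has_integral_const_real[of "1 :: complex" "- pi" pi] by (simp add: scaleR_conv_of_real)
next
  case False
  let ?F = "\<lambda>\<theta>. exp (\<i> * of_int n * complex_of_real \<theta>) / (\<i> * of_int n)"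
  have "((\<lambda>\<theta>. exp (\<i> * of_int n * complex_of_real \<theta>)) has_integral ?F pi - ?F (- pi)) {- pi..pi}"
    using False
    by (intro fundamental_theorem_of_calculus)
       (auto intro!: derivative_eq_intros has_vector_derivative_real_field simp: field_simps)
  moreover have "exp (\<i> * of_int n * complex_of_real pi) = exp (\<i> * of_int n * complex_of_real (- pi))"
    using exp_eq[of "\<i> * of_int n * complex_of_real pi" "\<i> * of_int n * complex_of_real (- pi)"]
    by (auto simp: algebra_simps)
  ultimately show ?thesis
    using False by simp
qed

text \<open>
  Expanding the square, only the products of coefficients at distance \<open>k\<close> survive: the
  Fourier coefficients of \<open>\<bar>P\<bar>\<^sup>2\<close> are the autocorrelations of the coefficient sequence of \<open>P\<close>.
\<close>
lemma has_integral_cmod_square: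
  fixes p :: "nat \<Rightarrow> real"
  shows "((\<lambda>\<theta>. of_real ((cmod (\<Sum>m\<le>i. of_real (p m) * cis \<theta> ^ m))\<^sup>2) * exp (- \<i> * of_int (int k) * complex_of_real \<theta>))
     has_integral 2 * of_real pi * of_real (\<Sum>m | m + k \<le> i. p m * p (m + k))) {- pi..pi}"
proof -
  have "((\<lambda>\<theta>. \<Sum>m\<le>i. \<Sum>l\<le>i. of_real (p m * p l) * exp (\<i> * of_int (int m - int l - int k) * complex_of_real \<theta>))
    has_integral (\<Sum>m\<le>i. \<Sum>l\<le>i. of_real (p m * p l) * (if int m - int l - int k = 0 then 2 * of_real pi else 0))) {- pi..pi}"
    by (intro has_integral_sum finite_atMost has_integral_mult_right has_integral_exp_period)
  also have "(\<lambda>\<theta>. \<Sum>m\<le>i. \<Sum>l\<le>i. of_real (p m * p l) * exp (\<i> * of_int (int m - int l - int k) * complex_of_real \<theta>)) =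
    (\<lambda>\<theta>. of_real ((cmod (\<Sum>m\<le>i. of_real (p m) * cis \<theta> ^ m))\<^sup>2) * exp (- \<i> * of_int (int k) * complex_of_real \<theta>))"
  proof
    fix \<theta>
    have e: "cis \<theta> ^ m * cnj (cis \<theta> ^ l) * exp (- \<i> * of_int (int k) * complex_of_real \<theta>) =
        exp (\<i> * of_int (int m - int l - int k) * complex_of_real \<theta>)" for m l
      by (simp add: cis_conv_exp exp_of_nat_mult[symmetric] exp_cnj exp_add[symmetric] algebra_simps)
    have "of_real ((cmod (\<Sum>m\<le>i. of_real (p m) * cis \<theta> ^ m))\<^sup>2) =
        (\<Sum>m\<le>i. of_real (p m) * cis \<theta> ^ m) * cnj (\<Sum>l\<le>i. of_real (p l) * cis \<theta> ^ l)"
      by (rule complex_norm_square)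
    also have "\<dots> = (\<Sum>m\<le>i. \<Sum>l\<le>i. of_real (p m * p l) * (cis \<theta> ^ m * cnj (cis \<theta> ^ l)))"
      by (simp add: sum_product mult_ac)
    finally show "(\<Sum>m\<le>i. \<Sum>l\<le>i. of_real (p m * p l) * exp (\<i> * of_int (int m - int l - int k) * complex_of_real \<theta>)) =
      of_real ((cmod (\<Sum>m\<le>i. of_real (p m) * cis \<theta> ^ m))\<^sup>2) * exp (- \<i> * of_int (int k) * complex_of_real \<theta>)"
      by (simp only: sum_distrib_right mult.assoc e[unfolded mult.assoc])
  qed
  also have "(\<Sum>m\<le>i. \<Sum>l\<le>i. of_real (p m * p l) * (if int m - int l - int k = 0 then 2 * of_real pi else 0)) =
      (\<Sum>l\<le>i. \<Sum>m\<le>i. if m = l + k then 2 * of_real pi * complex_of_real (p l * p m) else 0)"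
    by (subst sum.swap) (intro sum.cong refl, auto)
  also have "\<dots> = (\<Sum>l\<le>i. if l + k \<le> i then 2 * of_real pi * complex_of_real (p l * p (l + k)) else 0)"
    by (simp add: sum.delta)
  also have "\<dots> = (\<Sum>l | l + k \<le> i. 2 * of_real pi * complex_of_real (p l * p (l + k)))"
    by (subst sum.inter_filter[symmetric]) (auto intro!: sum.cong)
  finally show ?thesis
    by (simp add: sum_distrib_left)
qed

text \<open>
  The substitution \<open>t = (1 - cos \<theta>) / 2\<close> turns \<open>f / 2\<close>, which is even, into a positive
  continuous function on the unit interval; each term of its Bernstein series is the squared
  modulus of a polynomial \<open>\<Sum>m\<le>i. \<alpha> i a m * z ^ m\<close>, and the uniform convergence passes to the
  Fourier coefficients.
\<close>
theorem fourier_coeff_block_sums: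
  fixes f :: "real \<Rightarrow> real"
  assumes pos: "\<And>x. 0 < f x" and cont: "continuous_on UNIV f" and even: "\<And>x. f (- x) = f x"
  obtains \<alpha> :: "nat \<Rightarrow> nat \<Rightarrow> nat \<Rightarrow> real" where
    "\<And>k. (\<lambda>N. of_real (\<Sum>i<N. \<Sum>a\<le>i. \<Sum>m | m + k \<le> i. \<alpha> i a m * \<alpha> i a (m + k)))
       \<longlonglongrightarrow> 1 / 2 * fourier_coeff f (int k)"
proof -
  \<comment> \<open>Evenness of \<open>f\<close> makes \<open>f \<theta>\<close> a function of \<open>cos \<theta> = 1 - 2 * t\<close> on the whole period.\<close>
  let ?g = "\<lambda>t. f (arccos (1 - 2 * t)) / 2"
  let ?t = "\<lambda>\<theta>. (1 - cos \<theta>) / 2"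
  have t: "?t \<theta> \<in> {0..1}" for \<theta> :: real
    using cos_ge_minus_one[of \<theta>] cos_le_one[of \<theta>] by auto
  have cos_t: "1 - 2 * ?t \<theta> = cos \<theta>" for \<theta> :: real
    by (simp add: field_simps)
  have gt: "?g (?t \<theta>) = f \<theta> / 2" if "\<theta> \<in> {- pi..pi}" for \<theta>
  proof (cases "0 \<le> \<theta>")
    case True
    with that have "arccos (cos \<theta>) = \<theta>"
      by (intro arccos_cos) auto
    then show ?thesis unfolding cos_t by simp
  next
    case False
    then have "arccos (cos (- \<theta>)) = - \<theta>"
      using that by (intro arccos_cos) auto
    then show ?thesis unfolding cos_t cos_minus using even[of \<theta>] by simp
  qed
  have "continuous_on {0..1} (\<lambda>t :: real. arccos (1 - 2 * t))"
    by (intro continuous_intros) auto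
  then have g_cont: "continuous_on {0..1} ?g"
    by (intro continuous_intros continuous_on_compose2[OF cont]) auto
  have g_pos: "\<forall>t\<in>{0..1}. 0 < ?g t"
    using pos by simp
  obtain c where c: "\<And>i a. a \<le> i \<Longrightarrow> 0 \<le> c i a"
    and lim: "uniform_limit {0..1} (\<lambda>N t. \<Sum>i<N. \<Sum>a\<le>i. c i a * (t ^ a * (1 - t) ^ (i - a))) ?g sequentially"
    using positive_function_bernstein_series[OF g_pos g_cont] by blast
  define P where "P i a m = coeff (two_root_poly a (i - a)) m" for i a m
  define \<alpha> where "\<alpha> i a m = sqrt (c i a / 4 ^ i) * P i a m" for i a m
  define G where "G N \<theta> = (\<Sum>i<N. \<Sum>a\<le>i. c i a * (?t \<theta> ^ a * (1 - ?t \<theta>) ^ (i - a)))" for N \<theta>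
  have G: "G N \<theta> = (\<Sum>i<N. \<Sum>a\<le>i. (cmod (\<Sum>m\<le>i. of_real (\<alpha> i a m) * cis \<theta> ^ m))\<^sup>2)" for N \<theta>
  proof -
    have minus: "(cmod (1 - cis \<theta>))\<^sup>2 = 4 * ?t \<theta>" and plus: "(cmod (1 + cis \<theta>))\<^sup>2 = 4 * (1 - ?t \<theta>)"
      unfolding cmod_power2 by (simp_all add: power2_sum power2_diff cos_squared_eq field_simps)
    have "c i a * (?t \<theta> ^ a * (1 - ?t \<theta>) ^ (i - a)) = (cmod (\<Sum>m\<le>i. of_real (\<alpha> i a m) * cis \<theta> ^ m))\<^sup>2"
      if "a \<le> i" for i a
    proof -
      have "(\<Sum>m\<le>i. of_real (\<alpha> i a m) * cis \<theta> ^ m) =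
          of_real (sqrt (c i a / 4 ^ i)) * (\<Sum>m\<le>i. of_real (P i a m) * cis \<theta> ^ m)"
        by (simp add: \<alpha>_def sum_distrib_left mult_ac)
      also have "\<dots> = of_real (sqrt (c i a / 4 ^ i)) * ((1 - cis \<theta>) ^ a * (1 + cis \<theta>) ^ (i - a))"
        unfolding P_def using that by (subst two_root_poly_eval) auto
      finally have "(cmod (\<Sum>m\<le>i. of_real (\<alpha> i a m) * cis \<theta> ^ m))\<^sup>2 =
          (sqrt (c i a / 4 ^ i))\<^sup>2 * (((cmod (1 - cis \<theta>))\<^sup>2) ^ a * ((cmod (1 + cis \<theta>))\<^sup>2) ^ (i - a))"
        by (simp add: norm_mult norm_power power_mult_distrib power_mult[symmetric] mult.commute)
      also have "(sqrt (c i a / 4 ^ i))\<^sup>2 = c i a / 4 ^ i"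
        using c[OF that] by simp
      also have "((cmod (1 - cis \<theta>))\<^sup>2) ^ a * ((cmod (1 + cis \<theta>))\<^sup>2) ^ (i - a) =
          4 ^ i * (?t \<theta> ^ a * (1 - ?t \<theta>) ^ (i - a))"
      proof -
        have "(4 :: real) ^ i = 4 ^ a * 4 ^ (i - a)"
          using that by (simp add: power_add[symmetric])
        then show ?thesis
          unfolding minus plus power_mult_distrib by (simp only: mult_ac)
      qed
      finally show ?thesis
        by simp
    qed
    then show ?thesis
      unfolding G_def by (intro sum.cong refl) auto
  qed
  have "(\<lambda>N. of_real (\<Sum>i<N. \<Sum>a\<le>i. \<Sum>m | m + k \<le> i. \<alpha> i a m * \<alpha> i a (m + k)))
       \<longlonglongrightarrow> 1 / 2 * fourier_coeff f (int k)" for k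
  proof -
    let ?e = "\<lambda>\<theta>. exp (- \<i> * of_int (int k) * complex_of_real \<theta>)"
    let ?S = "\<lambda>N. \<Sum>i<N. \<Sum>a\<le>i. \<Sum>m | m + k \<le> i. \<alpha> i a m * \<alpha> i a (m + k)"
    have int: "((\<lambda>\<theta>. of_real (G N \<theta>) * ?e \<theta>) has_integral 2 * of_real pi * of_real (?S N)) {- pi..pi}" for N
    proof -
      have "((\<lambda>\<theta>. \<Sum>i<N. \<Sum>a\<le>i. of_real ((cmod (\<Sum>m\<le>i. of_real (\<alpha> i a m) * cis \<theta> ^ m))\<^sup>2) * ?e \<theta>)
        has_integral (\<Sum>i<N. \<Sum>a\<le>i. 2 * of_real pi * of_real (\<Sum>m | m + k \<le> i. \<alpha> i a m * \<alpha> i a (m + k)))) {- pi..pi}"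
        by (intro has_integral_sum finite_lessThan finite_atMost has_integral_cmod_square)
      then show ?thesis
        unfolding G by (simp only: of_real_sum sum_distrib_right sum_distrib_left)
    qed
    have norm_e: "cmod (?e \<theta>) = 1" for \<theta>
      by (simp add: norm_exp_eq_Re)
    have "uniform_limit {- pi..pi} (\<lambda>N \<theta>. of_real (G N \<theta>) * ?e \<theta>) (\<lambda>\<theta>. of_real (f \<theta> / 2) * ?e \<theta>) sequentially"
    proof (rule uniform_limitI)
      fix e :: real assume "0 < e"
      from uniform_limitD[OF lim this]
      show "\<forall>\<^sub>F N in sequentially. \<forall>\<theta>\<in>{- pi..pi}. dist (of_real (G N \<theta>) * ?e \<theta>) (of_real (f \<theta> / 2) * ?e \<theta>) < e"
      proof eventually_elim
        case (elim N)
        show ?case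
        proof
          fix \<theta> assume \<theta>: "\<theta> \<in> {- pi..pi}"
          have "dist (of_real (G N \<theta>) * ?e \<theta>) (of_real (f \<theta> / 2) * ?e \<theta>) = \<bar>G N \<theta> - f \<theta> / 2\<bar>"
            unfolding dist_norm left_diff_distrib[symmetric] norm_mult norm_e of_real_diff[symmetric] norm_of_real
            by simp
          also have "\<dots> < e"
            using elim t[of \<theta>] unfolding G_def gt[OF \<theta>, symmetric] dist_real_def by blast
          finally show "dist (of_real (G N \<theta>) * ?e \<theta>) (of_real (f \<theta> / 2) * ?e \<theta>) < e" .
        qed
      qed
    qed
    then obtain I J where IJ: "\<And>N. ((\<lambda>\<theta>. of_real (G N \<theta>) * ?e \<theta>) has_integral I N) {- pi..pi}"
        "((\<lambda>\<theta>. of_real (f \<theta> / 2) * ?e \<theta>) has_integral J) {- pi..pi}" "I \<longlonglongrightarrow> J"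
      by (rule uniform_limit_integral) (auto simp: G_def intro!: continuous_intros)
    have "I N = 2 * of_real pi * of_real (?S N)" for N
      using has_integral_unique[OF IJ(1) int] .
    moreover have "J = of_real pi * fourier_coeff f (int k)"
    proof -
      have "((\<lambda>\<theta>. 2 * (of_real (f \<theta> / 2) * ?e \<theta>)) has_integral 2 * J) {- pi..pi}"
        by (intro has_integral_mult_right IJ)
      then have "integral {- pi..pi} (\<lambda>\<theta>. of_real (f \<theta>) * ?e \<theta>) = 2 * J"
        by (intro integral_unique) (simp add: mult.assoc)
      then show ?thesis
        by (simp add: fourier_coeff_def)
    qed
    ultimately have "(\<lambda>N. 2 * of_real pi * of_real (?S N)) \<longlonglongrightarrow> of_real pi * fourier_coeff f (int k)"
      using IJ(3) by (simp add: LIMSEQ_def)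
    then have "(\<lambda>N. (2 * of_real pi * of_real (?S N)) / (2 * of_real pi)) \<longlonglongrightarrow> of_real pi * fourier_coeff f (int k) / (2 * of_real pi)"
      by (rule tendsto_divide[OF _ tendsto_const]) simp
    then show ?thesis
      by simp
  qed
  then show ?thesis
    by (rule that)
qed

section \<open>The path law on initial segments\<close>

fun trajectory :: "('s \<Rightarrow> 's pmf) \<Rightarrow> nat \<Rightarrow> 's \<Rightarrow> 's list pmf" where
  "trajectory K 0 x = return_pmf [x]"
| "trajectory K (Suc n) x = bind_pmf (K x) (\<lambda>y. map_pmf ((#) x) (trajectory K n y))"

lemma pmf_map_Cons: "pmf (map_pmf ((#) x) p) (y # ys) = (if x = y then pmf p ys else 0)"
proof (cases "x = y")
  case True
  then show ?thesis
    using pmf_map_inj'[of "(#) x" p ys] by (simp add: inj_def)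
next
  case False
  then have "y # ys \<notin> set_pmf (map_pmf ((#) x) p)"
    by auto
  then have "pmf (map_pmf ((#) x) p) (y # ys) = 0"
    by (rule iffD2[OF pmf_eq_0_set_pmf])
  with False show ?thesis
    by simp
qed

lemma set_trajectory: "xs \<in> set_pmf (trajectory K n x) \<Longrightarrow> length xs = Suc n \<and> hd xs = x"
  by (induction n arbitrary: x xs) auto

lemma pmf_trajectory:
  assumes "length xs = Suc n"
  shows "pmf (trajectory K n x) xs =
    (if xs ! 0 = x then \<Prod>i<n. pmf (K (xs ! i)) (xs ! Suc i) else 0)"
  using assms
proof (induction n arbitrary: x xs)
  case 0
  then obtain y where "xs = [y]"
    by (cases xs) auto
  then show ?case
    by (auto simp: pmf_return)
next
  case (Suc n)
  then obtain y ys where xs: "xs = y # ys" "length ys = Suc n"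
    by (cases xs) auto
  have "pmf (trajectory K (Suc n) x) xs =
      (\<integral>z. (if x = y then pmf (trajectory K n z) ys else 0) \<partial>K x)"
    by (simp add: pmf_bind xs pmf_map_Cons)
  also have "\<dots> = (\<integral>z. (if x = y then (\<Prod>i<n. pmf (K (ys ! i)) (ys ! Suc i)) * indicator {ys ! 0} z else 0) \<partial>K x)"
    by (intro Bochner_Integration.integral_cong) (auto simp: Suc.IH[OF xs(2)])
  also have "\<dots> = (if x = y then (\<Prod>i<n. pmf (K (ys ! i)) (ys ! Suc i)) * pmf (K x) (ys ! 0) else 0)"
    by (auto simp: measure_pmf_single)
  finally show ?case
    by (simp add: xs prod.lessThan_Suc_shift mult.commute del: prod.lessThan_Suc)
qed

lemma pmf_bind_trajectory:
  assumes "length xs = Suc n"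
  shows "pmf (bind_pmf \<mu> (trajectory K n)) xs =
    pmf \<mu> (xs ! 0) * (\<Prod>i<n. pmf (K (xs ! i)) (xs ! Suc i))"
proof -
  have "pmf (bind_pmf \<mu> (trajectory K n)) xs =
      (\<integral>x. (\<Prod>i<n. pmf (K (xs ! i)) (xs ! Suc i)) * indicator {xs ! 0} x \<partial>\<mu>)"
    unfolding pmf_bind
    by (intro Bochner_Integration.integral_cong) (auto simp: pmf_trajectory[OF assms])
  then show ?thesis
    by (simp add: measure_pmf_single)
qed

lemma measurable_path_law_coordinate [measurable]:
  "(\<lambda>\<omega>. \<omega> i) \<in> measurable (path_law \<mu> K) (count_space UNIV)"
  unfolding measurable_cong_sets[OF sets_path_law refl]
  by (rule measurable_component_singleton) simp

lemma space_path_law [simp]: "space (path_law \<mu> K) = UNIV"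
  using sets_eq_imp_space_eq[OF sets_path_law] by (simp add: space_PiM)

lemma measurable_path_law_prefix [measurable]:
  "(\<lambda>\<omega>. map \<omega> [0..<n]) \<in> measurable (path_law \<mu> (K :: 's :: countable \<Rightarrow> 's pmf)) (count_space UNIV)"
proof (induction n)
  case (Suc n)
  note [measurable] = Suc
  have "(\<lambda>\<omega>. (\<lambda>(xs, x). xs @ [x]) (map \<omega> [0..<n], \<omega> n))
      \<in> measurable (path_law \<mu> K) (count_space UNIV)"
    by measurable
  then show ?case
    by simp
qed simp

text \<open>
  All events used below depend on finitely many coordinates. On the countable set of lists,
  the law of an initial segment is determined by its point masses, which are the
  finite-dimensional distributions of the path law.
\<close>
lemma distr_path_law_prefix:
  fixes K :: "'s :: countable \<Rightarrow> 's pmf"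
  shows "distr (path_law \<mu> K) (count_space UNIV) (\<lambda>\<omega>. map \<omega> [0..<Suc n]) =
    measure_pmf (bind_pmf \<mu> (trajectory K n))"
proof (rule measure_eqI_countable[where A = UNIV])
  fix xs :: "'s list"
  let ?X = "\<lambda>\<omega>. map \<omega> [0..<Suc n] :: 's list"
  have *: "emeasure (distr (path_law \<mu> K) (count_space UNIV) ?X) {xs} =
      emeasure (path_law \<mu> K) (?X -` {xs})"
    by (subst emeasure_distr) (auto simp del: upt_Suc)
  show "emeasure (distr (path_law \<mu> K) (count_space UNIV) ?X) {xs} =
      emeasure (measure_pmf (bind_pmf \<mu> (trajectory K n))) {xs}"
  proof (cases "length xs = Suc n")
    case True
    then have "?X -` {xs} = {\<omega>. \<forall>i\<le>n. \<omega> i = xs ! i}"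
      by (auto simp: list_eq_iff_nth_eq simp del: upt_Suc)
    with * show ?thesis
      by (simp add: emeasure_path_law emeasure_pmf_single pmf_bind_trajectory[OF True] del: emeasure_bind_pmf)
  next
    case False
    then have "?X -` {xs} = {}"
      by (auto simp del: upt_Suc)
    moreover have "xs \<notin> set_pmf (bind_pmf \<mu> (trajectory K n))"
      using False by (auto dest: set_trajectory)
    then have "pmf (bind_pmf \<mu> (trajectory K n)) xs = 0"
      by (rule iffD2[OF pmf_eq_0_set_pmf])
    ultimately show ?thesis
      using * by (simp add: emeasure_pmf_single del: emeasure_bind_pmf upt_Suc)
  qed
qed auto

lemma nstep_0: "nstep K 0 x = return_pmf x"
  by (simp add: nstep_def)

lemma nstep_Suc_right: "nstep K (Suc n) x = bind_pmf (nstep K n x) K"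
  by (simp add: nstep_def)

lemma nstep_Suc_left: "nstep K (Suc n) x = bind_pmf (K x) (nstep K n)"
proof (induction n)
  case 0
  show ?case
    by (simp add: nstep_def bind_return_pmf bind_return_pmf')
next
  case (Suc n)
  have "nstep K (Suc (Suc n)) x = bind_pmf (nstep K (Suc n) x) K"
    by (rule nstep_Suc_right)
  also have "\<dots> = bind_pmf (K x) (\<lambda>y. bind_pmf (nstep K n y) K)"
    by (simp add: Suc bind_assoc_pmf)
  also have "\<dots> = bind_pmf (K x) (nstep K (Suc n))"
    by (simp add: nstep_Suc_right[abs_def])
  finally show ?case .
qed

lemma nstep_add: "nstep K (m + n) x = bind_pmf (nstep K m x) (nstep K n)"
proof (induction m arbitrary: x)
  case 0
  show ?case
    by (simp add: nstep_0 bind_return_pmf)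
next
  case (Suc m)
  have "nstep K (m + n) = (\<lambda>y. bind_pmf (nstep K m y) (nstep K n))"
    using Suc by blast
  then show ?case
    by (simp add: nstep_Suc_left bind_assoc_pmf)
qed

lemma trajectory_endpoints:
  "map_pmf (\<lambda>xs. (hd xs, last xs)) (trajectory K n x) = map_pmf (Pair x) (nstep K n x)"
proof -
  have l: "map_pmf last (trajectory K n x) = nstep K n x" for x
  proof (induction n arbitrary: x)
    case 0
    show ?case by (simp add: nstep_0)
  next
    case (Suc n)
    have "map_pmf (\<lambda>xs. last (x # xs)) (trajectory K n y) = map_pmf last (trajectory K n y)" for y
      by (intro map_pmf_cong) (auto dest: set_trajectory)
    then show ?case
      by (simp add: nstep_Suc_left map_bind_pmf pmf.map_comp o_def Suc)
  qed
  have "map_pmf (\<lambda>xs. (hd xs, last xs)) (trajectory K n x) =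
      map_pmf (\<lambda>xs. (x, last xs)) (trajectory K n x)"
    by (intro map_pmf_cong) (auto dest: set_trajectory)
  also have "\<dots> = map_pmf (Pair x) (map_pmf last (trajectory K n x))"
    by (simp add: pmf.map_comp o_def)
  finally show ?thesis
    by (simp add: l)
qed

text \<open>
  The law of \<open>(X\<^sub>0, X\<^sub>k)\<close>, through which the path law enters the autocovariances.
\<close>
definition joint_law :: "'s pmf \<Rightarrow> ('s \<Rightarrow> 's pmf) \<Rightarrow> nat \<Rightarrow> ('s \<times> 's) pmf" where
  "joint_law \<mu> K k = bind_pmf \<mu> (\<lambda>x. map_pmf (Pair x) (nstep K k x))"

lemma integral_path_law_pair:
  fixes K :: "'s :: countable \<Rightarrow> 's pmf" and g :: "'s \<Rightarrow> 's \<Rightarrow> real"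
  shows "(\<integral>\<omega>. g (\<omega> 0) (\<omega> k) \<partial>path_law \<mu> K) = measure_pmf.expectation (joint_law \<mu> K k) (\<lambda>(x, y). g x y)"
proof -
  let ?h = "\<lambda>xs. g (hd xs) (last xs)"
  have "(\<integral>\<omega>. g (\<omega> 0) (\<omega> k) \<partial>path_law \<mu> K) = (\<integral>\<omega>. ?h (map \<omega> [0..<Suc k]) \<partial>path_law \<mu> K)"
    by (simp add: hd_map del: upt_Suc) (simp add: upt_conv_Cons)
  also have "\<dots> = (\<integral>xs. ?h xs \<partial>distr (path_law \<mu> K) (count_space UNIV) (\<lambda>\<omega>. map \<omega> [0..<Suc k]))"
    by (rule integral_distr[symmetric]) (auto simp del: upt_Suc)
  also have "\<dots> = measure_pmf.expectation (map_pmf (\<lambda>xs. (hd xs, last xs)) (bind_pmf \<mu> (trajectory K k))) (\<lambda>(x, y). g x y)"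
    unfolding distr_path_law_prefix by simp
  also have "map_pmf (\<lambda>xs. (hd xs, last xs)) (bind_pmf \<mu> (trajectory K k)) = joint_law \<mu> K k"
    by (simp add: map_bind_pmf trajectory_endpoints joint_law_def)
  finally show ?thesis .
qed

lemma fst_joint_law: "map_pmf fst (joint_law \<mu> K k) = \<mu>"
  unfolding joint_law_def map_bind_pmf pmf.map_comp o_def fst_conv map_pmf_const by (rule bind_return_pmf')

lemma snd_joint_law:
  assumes "bind_pmf \<mu> K = \<mu>"
  shows "map_pmf snd (joint_law \<mu> K k) = \<mu>"
proof -
  have "bind_pmf \<mu> (nstep K k) = \<mu>"
  proof (induction k)
    case 0
    show ?case
      unfolding nstep_0[abs_def] by (rule bind_return_pmf')
  next
    case (Suc k)
    have "bind_pmf \<mu> (nstep K (Suc k)) = bind_pmf (bind_pmf \<mu> K) (nstep K k)"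
      unfolding nstep_Suc_left[abs_def] bind_assoc_pmf ..
    then show ?case
      by (simp only: assms Suc)
  qed
  then show ?thesis
    unfolding joint_law_def map_bind_pmf pmf.map_comp o_def snd_conv by simp
qed

section \<open>Return times of a stationary chain\<close>

lemma measurable_return_time [measurable]:
  "return_time x \<in> measurable (path_law \<mu> (K :: 's :: countable \<Rightarrow> 's pmf)) (count_space UNIV)"
proof -
  have "return_time x = (\<lambda>\<omega>. INF n\<in>{0<..}. if \<omega> n = x then enat n else \<infinity>)"
  proof
    fix \<omega>
    show "return_time x \<omega> = (INF n\<in>{0<..}. if \<omega> n = x then enat n else \<infinity>)"
      unfolding return_time_def
    proof (intro antisym INF_greatest)
      fix n :: nat assume "n \<in> {0<..}"
      then show "(INF n\<in>{n. 0 < n \<and> \<omega> n = x}. enat n) \<le> (if \<omega> n = x then enat n else \<infinity>)"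
        by (auto intro: INF_lower)
    next
      fix n assume "n \<in> {n. 0 < n \<and> \<omega> n = x}"
      then have "n \<in> {0<..}" and "(if \<omega> n = x then enat n else \<infinity>) \<le> enat n"
        by auto
      then show "(INF n\<in>{0<..}. if \<omega> n = x then enat n else \<infinity>) \<le> enat n"
        by (rule INF_lower2)
    qed
  qed
  moreover have "(\<lambda>\<omega>. INF n\<in>{0<..}. if \<omega> n = x then enat n else \<infinity>) \<in>
      measurable (path_law \<mu> K) (count_space UNIV)"
    by (rule measurable_INF) (auto intro: countableI_type)
  ultimately show ?thesis
    by metis
qed

lemma less_return_time_iff: "enat n < return_time x \<omega> \<longleftrightarrow> x \<notin> set (tl (map \<omega> [0..<Suc n]))"
proof -
  have "return_time x \<omega> \<le> enat n \<longleftrightarrow> (\<exists>i\<in>{0<..n}. \<omega> i = x)"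
  proof
    assume a: "return_time x \<omega> \<le> enat n"
    let ?A = "{i. 0 < i \<and> \<omega> i = x}"
    from a have "?A \<noteq> {}"
      unfolding return_time_def by (metis image_empty Inf_empty infinity_ileE top_enat_def)
    then obtain j where "enat j \<in> enat ` ?A"
      by blast
    then have "return_time x \<omega> \<in> enat ` ?A"
      unfolding return_time_def by (rule wellorder_InfI)
    with a show "\<exists>i\<in>{0<..n}. \<omega> i = x"
      by auto
  next
    assume "\<exists>i\<in>{0<..n}. \<omega> i = x"
    then obtain i where "i \<in> {n. 0 < n \<and> \<omega> n = x}" and "enat i \<le> enat n"
      by auto
    then show "return_time x \<omega> \<le> enat n"
      unfolding return_time_def by (rule INF_lower2)
  qed
  moreover have "set (tl (map \<omega> [0..<Suc n])) = \<omega> ` {0<..n}"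
    unfolding upt_conv_Cons[OF zero_less_Suc] by auto
  ultimately show ?thesis
    unfolding not_le[symmetric] by auto
qed

lemma nn_integral_return_time:
  fixes K :: "'s :: countable \<Rightarrow> 's pmf"
  shows "(\<integral>\<^sup>+\<omega>. ennreal_of_enat (return_time x \<omega>) \<partial>path_law (return_pmf x) K) =
    (\<Sum>n. emeasure (trajectory K n x) {xs. x \<notin> set (tl xs)})"
proof -
  have "emeasure (path_law (return_pmf x) K) {\<omega> \<in> space (path_law (return_pmf x) K). enat n < return_time x \<omega>} =
      emeasure (trajectory K n x) {xs. x \<notin> set (tl xs)}" for n
  proof -
    have "emeasure (distr (path_law (return_pmf x) K) (count_space UNIV) (\<lambda>\<omega>. map \<omega> [0..<Suc n])) {xs. x \<notin> set (tl xs)} =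
      emeasure (path_law (return_pmf x) K) {\<omega>. enat n < return_time x \<omega>}"
      by (subst emeasure_distr)
         (auto simp: less_return_time_iff simp del: upt_Suc intro!: arg_cong2[where f = emeasure])
    then show ?thesis
      unfolding distr_path_law_prefix by (simp add: bind_return_pmf)
  qed
  then show ?thesis
    by (subst nn_integral_enat_function) auto
qed

text \<open>
  One half of Kac's formula \<open>\<mu>(x) E\<^sub>x T = 1\<close>. Let \<open>u n\<close> be the probability that the
  stationary chain avoids \<open>x\<close> at the times \<open>0, \<dots>, n\<close>. By stationarity \<open>u n\<close> is also the
  probability of avoiding \<open>x\<close> at the times \<open>1, \<dots>, n + 1\<close>, and splitting this event
  according to whether the chain is at \<open>x\<close> at time \<open>0\<close> gives
  \<open>u n = u (n + 1) + \<mu>(x) P\<^sub>x(T > n + 1)\<close>. The sum over \<open>n\<close> telescopes.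
\<close>
lemma kac_inequality:
  fixes K :: "'s :: countable \<Rightarrow> 's pmf"
  assumes stat: "bind_pmf \<mu> K = \<mu>"
  shows "ennreal (pmf \<mu> x) *
    (\<integral>\<^sup>+\<omega>. ennreal_of_enat (return_time x \<omega>) \<partial>path_law (return_pmf x) K) \<le> 1"
proof -
  define T where "T n = bind_pmf \<mu> (trajectory K n)" for n
  define q where "q n = emeasure (trajectory K n x) {xs. x \<notin> set (tl xs)}" for n
  define u where "u n = emeasure (T n) {xs. x \<notin> set xs}" for n
  have split: "emeasure (T n) {xs. x \<notin> set (tl xs)} = u n + ennreal (pmf \<mu> x) * q n" for n
  proof -
    have "emeasure (T n) {xs. x \<notin> set (tl xs)} =
      emeasure (T n) ({xs. x \<notin> set xs} \<union> {xs. hd xs = x \<and> x \<notin> set (tl xs)} \<inter> {xs. xs \<noteq> []})"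
    proof (rule emeasure_eq_AE)
      have "xs \<noteq> []" if "xs \<in> set_pmf (T n)" for xs
        using that by (auto simp: T_def dest: set_trajectory)
      then have "x \<notin> set (tl xs) \<longleftrightarrow> x \<notin> set xs \<or> (hd xs = x \<and> x \<notin> set (tl xs)) \<and> xs \<noteq> []"
        if "xs \<in> set_pmf (T n)" for xs
        using that by (cases xs) auto
      then show "AE xs in T n. xs \<in> {xs. x \<notin> set (tl xs)} \<longleftrightarrow>
          xs \<in> {xs. x \<notin> set xs} \<union> {xs. hd xs = x \<and> x \<notin> set (tl xs)} \<inter> {xs. xs \<noteq> []}"
        by (simp add: AE_measure_pmf_iff)
    qed simp_all
    also have "\<dots> = u n + emeasure (T n) ({xs. hd xs = x \<and> x \<notin> set (tl xs)} \<inter> {xs. xs \<noteq> []})"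
      unfolding u_def by (intro plus_emeasure[symmetric]) auto
    also have "emeasure (T n) ({xs. hd xs = x \<and> x \<notin> set (tl xs)} \<inter> {xs. xs \<noteq> []}) =
        (\<integral>\<^sup>+y. emeasure (trajectory K n y) ({xs. hd xs = x \<and> x \<notin> set (tl xs)} \<inter> {xs. xs \<noteq> []}) \<partial>\<mu>)"
      by (simp add: T_def)
    also have "\<dots> = (\<integral>\<^sup>+y. q n * indicator {x} y \<partial>\<mu>)"
    proof (intro nn_integral_cong)
      fix y
      have "emeasure (trajectory K n y) ({xs. hd xs = x \<and> x \<notin> set (tl xs)} \<inter> {xs. xs \<noteq> []}) =
          emeasure (trajectory K n y) (if y = x then {xs. x \<notin> set (tl xs)} else {})"
        by (intro emeasure_eq_AE) (auto simp: AE_measure_pmf_iff dest: set_trajectory)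
      then show "emeasure (trajectory K n y) ({xs. hd xs = x \<and> x \<notin> set (tl xs)} \<inter> {xs. xs \<noteq> []}) =
          q n * indicator {x} y"
        by (simp add: q_def)
    qed
    also have "\<dots> = ennreal (pmf \<mu> x) * q n"
      by (simp add: nn_integral_cmult emeasure_pmf_single mult.commute)
    finally show ?thesis .
  qed
  have shift: "emeasure (T (Suc n)) {xs. x \<notin> set (tl xs)} = u n" for n
  proof -
    have "emeasure (T (Suc n)) {xs. x \<notin> set (tl xs)} = emeasure (map_pmf tl (T (Suc n))) {xs. x \<notin> set xs}"
      by (simp add: vimage_def del: emeasure_bind_pmf)
    also have "map_pmf tl (T (Suc n)) = bind_pmf (bind_pmf \<mu> K) (trajectory K n)"
      by (simp add: T_def map_bind_pmf pmf.map_comp o_def bind_assoc_pmf)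
    finally show ?thesis
      by (simp add: stat u_def T_def)
  qed
  \<comment> \<open>The telescoped identity, written additively to avoid subtraction in \<^typ>\<open>ennreal\<close>.\<close>
  have part: "(\<Sum>n<Suc N. ennreal (pmf \<mu> x) * q n) + u N = 1" for N
  proof (induction N)
    case 0
    have "emeasure (T 0) {xs. x \<notin> set (tl xs)} = 1"
      by (simp add: T_def indicator_def)
    with split[of 0] show ?case
      by (simp add: add.commute)
  next
    case (Suc N)
    then show ?case
      using split[of "Suc N"] shift[of N] by (simp add: add_ac)
  qed
  have "(\<Sum>n<N. ennreal (pmf \<mu> x) * q n) \<le> 1" for N
  proof (cases N)
    case (Suc M)
    then show ?thesis
      using part[of M] by (metis le_iff_add)
  qed simp
  then have "(\<Sum>n. ennreal (pmf \<mu> x) * q n) \<le> 1"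
    by (intro suminf_le_const) auto
  then show ?thesis
    by (simp add: nn_integral_return_time q_def ennreal_suminf_cmult)
qed

lemma positive_recurrent_if_stationary:
  fixes K :: "'s :: countable \<Rightarrow> 's pmf"
  assumes "bind_pmf \<mu> K = \<mu>" and "S \<subseteq> set_pmf \<mu>"
  shows "positive_recurrent_chain S K"
  unfolding positive_recurrent_chain_def
proof
  fix x assume "x \<in> S"
  with assms(2) have "0 < pmf \<mu> x"
    by (auto simp: pmf_positive)
  then show "(\<integral>\<^sup>+\<omega>. ennreal_of_enat (return_time x \<omega>) \<partial>path_law (return_pmf x) K) < \<infinity>"
    using kac_inequality[OF assms(1), of x] by (auto simp: less_top[symmetric] ennreal_mult_eq_top_iff top_unique)
qed

section \<open>The block chain\<close>

abbreviation geom :: "nat pmf" where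
  "geom \<equiv> geometric_pmf (1 / 2)"

text \<open>
  A state \<open>(l, m, n)\<close> stands for a position in a block with label \<open>l\<close>: \<open>m\<close> steps of the block
  have been made and \<open>n\<close> remain, so that the block has length \<open>m + n + 1\<close>.
\<close>
definition fresh_block :: "'l pmf \<Rightarrow> ('l \<times> nat \<times> nat) pmf" where
  "fresh_block L = map_pmf (\<lambda>(l, n). (l, 0, n)) (pair_pmf L geom)"

fun block_kernel :: "'l pmf \<Rightarrow> 'l \<times> nat \<times> nat \<Rightarrow> ('l \<times> nat \<times> nat) pmf" where
  "block_kernel L (l, m, 0) = fresh_block L"
| "block_kernel L (l, m, Suc n) = return_pmf (l, Suc m, n)"

text \<open>
  The mass of \<open>(l, m, n)\<close> depends on \<open>l\<close> and \<open>m + n\<close> only, which is why moving one step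
  within a block preserves this law.
\<close>
definition block_stationary :: "'l pmf \<Rightarrow> ('l \<times> nat \<times> nat) pmf" where
  "block_stationary L = pair_pmf L (pair_pmf geom geom)"

lemma pmf_fresh_block: "pmf (fresh_block L) (l, m, n) = (if m = 0 then pmf L l * pmf geom n else 0)"
proof (cases "m = 0")
  case True
  have "inj (\<lambda>(l :: 'a, n :: nat). (l, 0 :: nat, n))"
    by (auto simp: inj_def)
  from pmf_map_inj'[OF this, of "pair_pmf L geom" "(l, n)"] True show ?thesis
    by (simp add: fresh_block_def pmf_pair)
next
  case False
  then have "(l, m, n) \<notin> set_pmf (fresh_block L)"
    by (auto simp: fresh_block_def)
  then have "pmf (fresh_block L) (l, m, n) = 0"
    by (rule iffD2[OF pmf_eq_0_set_pmf])
  with False show ?thesis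
    by simp
qed

lemma pmf_block_stationary:
  "pmf (block_stationary L) (l, m, n) = pmf L l * (pmf geom m * pmf geom n)"
  by (simp add: block_stationary_def pmf_pair)

lemma set_block_stationary: "set_pmf L = UNIV \<Longrightarrow> set_pmf (block_stationary L) = UNIV"
  by (simp add: block_stationary_def set_pmf_geometric)

text \<open>
  A state with \<open>m > 0\<close> has the unique predecessor \<open>(l, m - 1, n + 1)\<close>, of the same mass. A
  state with \<open>m = 0\<close> is entered from the states with \<open>n = 0\<close>, whose total mass \<open>1/2\<close> equals
  the mass of \<open>0\<close> under the geometric law of \<open>m\<close>.
\<close>
lemma block_stationary_invariant: "bind_pmf (block_stationary L) (block_kernel L) = block_stationary L"
proof (rule pmf_eqI)
  fix s :: "'a \<times> nat \<times> nat"
  obtain l m n where s: "s = (l, m, n)"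
    by (cases s)
  show "pmf (bind_pmf (block_stationary L) (block_kernel L)) s = pmf (block_stationary L) s"
  proof (cases m)
    case 0
    have *: "pmf (block_kernel L x) s = pmf L l * pmf geom n * indicator {x. snd (snd x) = 0} x" for x
      by (cases "(L, x)" rule: block_kernel.cases) (auto simp: s 0 pmf_fresh_block pmf_return)
    have "measure_pmf.prob (block_stationary L) {x. snd (snd x) = 0} =
        measure_pmf.prob (map_pmf snd (map_pmf snd (block_stationary L))) {0}"
      by (simp add: vimage_def)
    also have "\<dots> = 1 / 2"
      by (simp add: block_stationary_def map_snd_pair_pmf measure_pmf_single)
    finally show ?thesis
      unfolding pmf_bind * by (simp add: pmf_block_stationary s 0)
  next
    case (Suc m')
    have "pmf (block_kernel L x) s = indicator {(l, m', Suc n)} x" for x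
      by (cases "(L, x)" rule: block_kernel.cases)
         (auto simp: s Suc pmf_fresh_block pmf_return split: split_indicator)
    then show ?thesis
      unfolding pmf_bind by (simp add: measure_pmf_single pmf_block_stationary s Suc)
  qed
qed

lemma nstep_within_block:
  "k \<le> n \<Longrightarrow> nstep (block_kernel L) k (l, m, n) = return_pmf (l, m + k, n - k)"
proof (induction k)
  case (Suc k)
  then obtain n' where "n - k = Suc n'" "n - Suc k = n'"
    by (cases "n - k") auto
  with Suc show ?case
    by (simp add: nstep_Suc_right bind_return_pmf)
qed (simp add: nstep_0)

lemma nstep_beyond_block:
  "nstep (block_kernel L) (Suc n + j) (l, m, n) = bind_pmf (fresh_block L) (nstep (block_kernel L) j)"
  unfolding nstep_add nstep_Suc_right[of _ n] nstep_within_block[OF order_refl]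
  by (simp add: bind_return_pmf)

text \<open>
  Finish the current block, then start a block that passes through the target.
\<close>
lemma reach_in_block:
  assumes "set_pmf L = UNIV"
  shows "(l', m', n') \<in> set_pmf (nstep (block_kernel L) (Suc n + m') (l, m, n))"
proof -
  have "(l', 0, m' + n') \<in> set_pmf (fresh_block L)"
    using assms by (auto simp: fresh_block_def set_pmf_geometric image_iff)
  then show ?thesis
    unfolding nstep_beyond_block set_bind_pmf
    by (rule UN_I) (simp add: nstep_within_block)
qed

text \<open>
  An additional block of length one delays the arrival by exactly one step. Together with
  the previous lemma it gives two consecutive possible return times, hence aperiodicity.
\<close>
lemma reach_one_step_later:
  assumes "set_pmf L = UNIV"
  shows "(l', m', n') \<in> set_pmf (nstep (block_kernel L) (Suc n + (Suc 0 + m')) (l, m, n))"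
proof -
  have "(l, 0, 0) \<in> set_pmf (fresh_block L)"
    using assms by (auto simp: fresh_block_def set_pmf_geometric image_iff)
  then show ?thesis
    unfolding nstep_beyond_block set_bind_pmf
    by (rule UN_I) (rule reach_in_block[OF assms])
qed

lemma irreducible_block_chain:
  assumes "set_pmf L = UNIV"
  shows "irreducible_chain UNIV (block_kernel L)"
  unfolding irreducible_chain_def
proof (intro ballI)
  fix x y :: "'a \<times> nat \<times> nat"
  obtain l m n l' m' n' where "x = (l, m, n)" "y = (l', m', n')"
    by (metis prod_cases3)
  then show "\<exists>n. 0 < pmf (nstep (block_kernel L) n x) y"
    using reach_in_block[OF assms, of l' m' n' n l m] by (metis pmf_positive)
qed

lemma aperiodic_block_chain:
  assumes "set_pmf L = UNIV"
  shows "aperiodic_chain UNIV (block_kernel L)"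
  unfolding aperiodic_chain_def
proof
  fix x :: "'a \<times> nat \<times> nat"
  obtain l m n where x: "x = (l, m, n)"
    by (cases x)
  let ?R = "{k. 0 < k \<and> 0 < pmf (nstep (block_kernel L) k x) x}"
  have "Suc n + m \<in> ?R" "Suc n + (Suc 0 + m) \<in> ?R"
    using reach_in_block[OF assms, of l m n n l m] reach_one_step_later[OF assms, of l m n n l m]
    by (auto simp: x pmf_positive)
  then have "Gcd ?R dvd Suc n + m" "Gcd ?R dvd Suc (Suc n + m)"
    by (auto intro: Gcd_dvd)
  then have "Gcd ?R dvd 1"
    by (metis dvd_add_right_iff plus_1_eq_Suc add.commute)
  then show "Gcd ?R = 1"
    by simp
qed

lemma nstep_intertwine:
  assumes K: "\<And>x. K (F x) = map_pmf F (K x)"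
  shows "nstep K j (F x) = map_pmf F (nstep K j x)"
proof (induction j arbitrary: x)
  case (Suc j)
  then show ?case
    by (simp add: nstep_Suc_left K bind_map_pmf map_bind_pmf)
qed (simp add: nstep_0)

section \<open>Autocovariances of odd observables\<close>

text \<open>
  The contribution to the autocovariance at lag \<open>k\<close> from the event that \<open>X\<^sub>0\<close> and \<open>X\<^sub>k\<close> belong
  to the same block, as a function of \<open>X\<^sub>0\<close>.
\<close>
definition same_block_product :: "('l \<times> nat \<times> nat \<Rightarrow> real) \<Rightarrow> nat \<Rightarrow> 'l \<times> nat \<times> nat \<Rightarrow> real" where
  "same_block_product h k = (\<lambda>(l, m, n). if k \<le> n then h (l, m, n) * h (l, m + k, n - k) else 0)"

context
  fixes L :: "'l pmf" and flip :: "'l \<Rightarrow> 'l" and h :: "'l \<times> nat \<times> nat \<Rightarrow> real"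
  assumes flip_L: "map_pmf flip L = L"
    and odd: "\<And>l m n. h (flip l, m, n) = - h (l, m, n)"
    and square_integrable: "integrable (block_stationary L) (\<lambda>x. (h x)\<^sup>2)"
begin

lemma fresh_block_flip: "map_pmf (map_prod flip id) (fresh_block L) = fresh_block L"
proof -
  have "map_pmf (map_prod flip id) (fresh_block L) = map_pmf (\<lambda>(l, n). (l, 0, n)) (pair_pmf (map_pmf flip L) geom)"
    unfolding fresh_block_def pair_map_pmf1 pmf.map_comp by (intro map_pmf_cong) auto
  then show ?thesis
    by (simp add: flip_L fresh_block_def)
qed

lemma block_kernel_flip: "block_kernel L (map_prod flip id x) = map_pmf (map_prod flip id) (block_kernel L x)"
  by (cases "(L, x)" rule: block_kernel.cases) (auto simp: fresh_block_flip)

lemma expectation_block_zero: "measure_pmf.expectation (block_stationary L) h = 0"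
proof -
  have "map_pmf (map_prod flip id) (block_stationary L) = block_stationary L"
    unfolding block_stationary_def map_prod_def pair_map_pmf1[symmetric]
    using flip_L pair_map_pmf1[of flip L "pair_pmf geom geom"] by (simp add: apfst_def map_prod_def)
  then have "measure_pmf.expectation (block_stationary L) h =
      measure_pmf.expectation (map_pmf (map_prod flip id) (block_stationary L)) h"
    by simp
  also have "\<dots> = measure_pmf.expectation (block_stationary L) (\<lambda>x. - h x)"
    unfolding integral_map_pmf by (intro Bochner_Integration.integral_cong) (auto simp: odd)
  finally show ?thesis
    by simp
qed

text \<open>
  The pair \<open>(X\<^sub>0, X\<^sub>k)\<close> keeps its law if the label of \<open>X\<^sub>k\<close> is flipped whenever the two
  states lie in different blocks, because a new block starts with a flip-invariant label
  independently of the past. The flip changes the sign of \<open>h X\<^sub>0 * h X\<^sub>k\<close>, so averaging over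
  it cancels the contribution of different blocks. Within a block the motion is
  deterministic, and \<open>X\<^sub>k\<close> is a function of \<open>X\<^sub>0\<close>.
\<close>
lemma block_autocovariance:
  shows "integrable (block_stationary L) (same_block_product h k)"
    and "measure_pmf.expectation (joint_law (block_stationary L) (block_kernel L) k) (\<lambda>(x, y). h x * h y) =
      measure_pmf.expectation (block_stationary L) (same_block_product h k)"
proof -
  let ?J = "joint_law (block_stationary L) (block_kernel L) k"
  let ?F = "map_prod flip (id :: nat \<times> nat \<Rightarrow> _)"
  let ?hh = "\<lambda>(x, y). h x * h y"
  let ?near = "\<lambda>x. k \<le> snd (snd x)"
  define \<phi> :: "('l \<times> nat \<times> nat) \<times> ('l \<times> nat \<times> nat) \<Rightarrow> _" where "\<phi> = (\<lambda>(x, y). (x, if ?near x then y else ?F y))"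
  have far: "map_pmf ?F (nstep (block_kernel L) k x) = nstep (block_kernel L) k x" if nf: "\<not> ?near x" for x
  proof -
    obtain l m n where x: "x = (l, m, n)"
      by (cases x)
    then obtain j where k: "k = Suc n + j"
      using nf by (metis less_iff_Suc_add not_le snd_conv add_Suc)
    have "map_pmf ?F (nstep (block_kernel L) k x) =
        bind_pmf (fresh_block L) (\<lambda>y. map_pmf ?F (nstep (block_kernel L) j y))"
      unfolding x k nstep_beyond_block map_bind_pmf ..
    also have "\<dots> = bind_pmf (map_pmf ?F (fresh_block L)) (nstep (block_kernel L) j)"
      unfolding bind_map_pmf nstep_intertwine[where K = "block_kernel L", OF block_kernel_flip] ..
    finally show ?thesis
      unfolding x k nstep_beyond_block fresh_block_flip .
  qed
  have "map_pmf \<phi> (map_pmf (Pair x) (nstep (block_kernel L) k x)) = map_pmf (Pair x) (nstep (block_kernel L) k x)" for x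
  proof (cases "?near x")
    case True
    then show ?thesis
      unfolding pmf.map_comp by (intro map_pmf_cong) (auto simp: \<phi>_def)
  next
    case False
    have "map_pmf \<phi> (map_pmf (Pair x) (nstep (block_kernel L) k x)) =
        map_pmf (Pair x) (map_pmf ?F (nstep (block_kernel L) k x))"
      using False unfolding pmf.map_comp by (intro map_pmf_cong) (auto simp: \<phi>_def)
    then show ?thesis
      by (simp only: far[OF False])
  qed
  then have inv: "map_pmf \<phi> ?J = ?J"
    by (simp add: joint_law_def map_bind_pmf)
  have int_fst: "integrable ?J (\<lambda>p. (h (fst p))\<^sup>2)"
    using square_integrable fst_joint_law[of "block_stationary L" "block_kernel L" k]
      integrable_map_pmf_eq[of fst ?J "\<lambda>x. (h x)\<^sup>2"] by simp
  have int_snd: "integrable ?J (\<lambda>p. (h (snd p))\<^sup>2)"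
    using square_integrable snd_joint_law[where k = k, OF block_stationary_invariant[of L]]
      integrable_map_pmf_eq[of snd ?J "\<lambda>x. (h x)\<^sup>2"] by simp
  \<comment> \<open>Both marginals of the joint law are stationary, so \<open>\<bar>x y\<bar> \<le> x\<^sup>2 + y\<^sup>2\<close> bounds the product
    by integrable functions.\<close>
  have int: "integrable ?J ?hh"
  proof (rule Bochner_Integration.integrable_bound[OF Bochner_Integration.integrable_add[OF int_fst int_snd]])
    have "\<bar>a * b\<bar> \<le> \<bar>a\<^sup>2 + b\<^sup>2\<bar>" for a b :: real
    proof -
      have "2 * (\<bar>a\<bar> * \<bar>b\<bar>) \<le> a\<^sup>2 + b\<^sup>2"
        using sum_squares_bound[of "\<bar>a\<bar>" "\<bar>b\<bar>"] by simp
      moreover have "0 \<le> \<bar>a\<bar> * \<bar>b\<bar>"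
        by simp
      ultimately show ?thesis
        unfolding abs_mult by linarith
    qed
    then show "AE p in ?J. norm (?hh p) \<le> norm ((h (fst p))\<^sup>2 + (h (snd p))\<^sup>2)"
      by (auto simp: split_beta)
  qed simp
  have int_\<phi>: "integrable ?J (\<lambda>p. ?hh (\<phi> p))"
    using int integrable_map_pmf_eq[of \<phi> ?J ?hh] unfolding inv by blast
  \<comment> \<open>Averaging over \<open>\<phi>\<close> kills the product exactly on the event of different blocks.\<close>
  have avg: "?hh p + ?hh (\<phi> p) = 2 * (if ?near (fst p) then ?hh p else 0)" for p
    by (cases p) (auto simp: \<phi>_def odd split: prod.splits)
  have AE: "AE p in ?J. (if ?near (fst p) then ?hh p else 0) = same_block_product h k (fst p)"
    by (auto simp: AE_measure_pmf_iff joint_law_def same_block_product_def nstep_within_block)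
  have int_near: "integrable ?J (\<lambda>p. if ?near (fst p) then ?hh p else 0)"
    using Bochner_Integration.integrable_add[OF int int_\<phi>] unfolding avg by simp
  then have "integrable ?J (\<lambda>p. same_block_product h k (fst p))"
    using integrable_cong_AE[OF _ _ AE] by simp
  then show "integrable (block_stationary L) (same_block_product h k)"
    using integrable_map_pmf_eq[of fst ?J "same_block_product h k"] by (simp add: fst_joint_law)
  have "2 * measure_pmf.expectation ?J ?hh = measure_pmf.expectation ?J ?hh + measure_pmf.expectation (map_pmf \<phi> ?J) ?hh"
    unfolding inv by simp
  also have "\<dots> = measure_pmf.expectation ?J (\<lambda>p. ?hh p + ?hh (\<phi> p))"
    unfolding integral_map_pmf by (rule Bochner_Integration.integral_add[OF int int_\<phi>, symmetric])
  also have "\<dots> = 2 * measure_pmf.expectation ?J (\<lambda>p. if ?near (fst p) then ?hh p else 0)"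
    unfolding avg by simp
  also have "measure_pmf.expectation ?J (\<lambda>p. if ?near (fst p) then ?hh p else 0) =
      measure_pmf.expectation ?J (\<lambda>p. same_block_product h k (fst p))"
    by (rule integral_cong_AE[OF _ _ AE]) auto
  also have "\<dots> = measure_pmf.expectation (map_pmf fst ?J) (same_block_product h k)"
    by simp
  finally show "measure_pmf.expectation ?J ?hh = measure_pmf.expectation (block_stationary L) (same_block_product h k)"
    by (simp add: fst_joint_law)
qed

end

section \<open>Transfer to the natural numbers\<close>

text \<open>
  The recoded chain lives on the range of \<^const>\<open>to_nat\<close>, where \<^const>\<open>from_nat\<close> decodes;
  at other numbers \<^const>\<open>from_nat\<close> supplies a default state.
\<close>
definition recode_kernel :: "('s :: countable \<Rightarrow> 's pmf) \<Rightarrow> nat \<Rightarrow> nat pmf" where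
  "recode_kernel K x = map_pmf to_nat (K (from_nat x))"

lemma nstep_recode: "nstep (recode_kernel K) n (to_nat x) = map_pmf to_nat (nstep K n x)"
  by (induction n) (simp_all add: nstep_0 nstep_Suc_right map_bind_pmf bind_map_pmf recode_kernel_def)

lemma recode_chain:
  fixes K :: "'s :: countable \<Rightarrow> 's pmf"
  assumes irr: "irreducible_chain UNIV K" and aper: "aperiodic_chain UNIV K"
    and stat: "bind_pmf \<mu> K = \<mu>" and supp: "set_pmf \<mu> = UNIV"
  defines "S \<equiv> range (to_nat :: 's \<Rightarrow> nat)" and "K' \<equiv> recode_kernel K" and "\<mu>' \<equiv> map_pmf to_nat \<mu>"
  shows "markov_kernel S K'" and "irreducible_chain S K'" and "aperiodic_chain S K'"
    and "positive_recurrent_chain S K'" and "stationary_distribution S K' \<mu>'"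
    and "joint_law \<mu>' K' k = map_pmf (map_prod to_nat to_nat) (joint_law \<mu> K k)"
proof -
  have inj: "inj (to_nat :: 's \<Rightarrow> nat)"
    by (rule inj_to_nat)
  have pmf: "pmf (nstep K' n (to_nat x)) (to_nat y) = pmf (nstep K n x) y" for n x y
    unfolding K'_def nstep_recode by (rule pmf_map_inj'[OF inj])
  have stat': "bind_pmf \<mu>' K' = \<mu>'"
    using arg_cong[OF stat, of "map_pmf to_nat"]
    by (simp add: \<mu>'_def K'_def recode_kernel_def bind_map_pmf map_bind_pmf)
  show "markov_kernel S K'"
    by (auto simp: markov_kernel_def S_def K'_def recode_kernel_def)
  show "irreducible_chain S K'"
    using irr by (simp add: irreducible_chain_def S_def pmf)
  show "aperiodic_chain S K'"
    using aper by (simp add: aperiodic_chain_def S_def pmf)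
  show "positive_recurrent_chain S K'"
    by (rule positive_recurrent_if_stationary[OF stat']) (auto simp: S_def \<mu>'_def supp)
  show "stationary_distribution S K' \<mu>'"
    using stat' by (auto simp: stationary_distribution_def S_def \<mu>'_def)
  show "joint_law \<mu>' K' k = map_pmf (map_prod to_nat to_nat) (joint_law \<mu> K k)"
    unfolding joint_law_def \<mu>'_def K'_def bind_map_pmf nstep_recode map_bind_pmf pmf.map_comp
    by (intro bind_pmf_cong map_pmf_cong) auto
qed

section \<open>Prescribed autocovariances\<close>

lemma integrable_measure_pmf_finite_support:
  fixes g :: "'a \<Rightarrow> real"
  assumes "finite A" and "\<And>x. g x \<noteq> 0 \<Longrightarrow> x \<in> A"
  shows "integrable (measure_pmf p) g"
proof (rule measure_pmf.integrable_const_bound)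
  have "\<bar>g x\<bar> \<le> (\<Sum>y\<in>A. \<bar>g y\<bar>)" for x
  proof (cases "x \<in> A")
    case True
    then show ?thesis
      using assms(1) by (intro member_le_sum) auto
  next
    case False
    then have "g x = 0"
      using assms(2) by blast
    then show ?thesis
      by (simp add: sum_nonneg)
  qed
  then show "AE x in p. norm (g x) \<le> (\<Sum>y\<in>A. \<bar>g y\<bar>)"
    by simp
qed simp

text \<open>
  A label is a fair sign, which makes the observable odd, together with the index \<open>a\<close> of a
  term in the double series for \<open>f / 2\<close>; the other index is the block length.
\<close>
definition signed_label :: "(bool \<times> nat) pmf" where
  "signed_label = pair_pmf (bernoulli_pmf (1 / 2)) geom"

lemma pmf_signed_block_stationary:
  "pmf (block_stationary signed_label) ((s, a), m, n) = (1 / 2) ^ (a + (m + n) + 4)"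
  by (simp add: pmf_block_stationary signed_label_def pmf_pair power_add)
     (cases s; simp add: power_add eval_nat_numeral)

text \<open>
  The block of length \<open>i + 1\<close> with label \<open>a\<close> carries the coefficients \<open>\<alpha> i a 0, \<dots>, \<alpha> i a i\<close>.
  The radicand \<open>(1 / 2) ^ (a + i + 3)\<close> is the stationary mass of any one of its positions,
  both signs together, so that products of two observables, weighted by this mass, are
  plain products of coefficients.
\<close>
definition block_observable :: "(nat \<Rightarrow> nat \<Rightarrow> nat \<Rightarrow> real) \<Rightarrow> (bool \<times> nat) \<times> nat \<times> nat \<Rightarrow> real" where
  "block_observable \<alpha> = (\<lambda>((s, a), m, n). (if s then 1 else - 1) *
     (if a \<le> m + n then \<alpha> (m + n) a m / sqrt ((1 / 2) ^ (a + (m + n) + 3)) else 0))"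

text \<open>
  The restriction to blocks of length at most \<open>N\<close> makes the sum finite, because
  \<open>a \<le> i = m + n\<close> wherever the observable does not vanish; the partial sums are those of the
  expansion of the Fourier coefficients.
\<close>
lemma block_observable_truncated:
  shows "integrable (block_stationary signed_label)
     (\<lambda>x. if fst (snd x) + snd (snd x) < N then same_block_product (block_observable \<alpha>) k x else 0)" (is ?int)
  and "measure_pmf.expectation (block_stationary signed_label)
     (\<lambda>x. if fst (snd x) + snd (snd x) < N then same_block_product (block_observable \<alpha>) k x else 0) =
   (\<Sum>i<N. \<Sum>a\<le>i. \<Sum>m | m + k \<le> i. \<alpha> i a m * \<alpha> i a (m + k))"
proof -
  let ?g = "\<lambda>x. if fst (snd x) + snd (snd x) < N then same_block_product (block_observable \<alpha>) k x else 0"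
  let ?I = "(UNIV :: bool set) \<times> (SIGMA i:{..<N}. {..i} \<times> {m. m + k \<le> i})"
  let ?e = "\<lambda>(s :: bool, i, a, m). ((s, a), m, i - m)"
  have fin: "finite ?I"
  proof (intro finite_cartesian_product finite_SigmaI)
    show "finite {m. m + k \<le> i}" for i
      by (rule finite_subset[of _ "{..i}"]) auto
  qed simp_all
  have inj: "inj_on ?e ?I"
    by (auto simp: inj_on_def)
  have supp: "x \<in> ?e ` ?I" if "?g x \<noteq> 0" for x
  proof -
    obtain s a m n where x: "x = ((s, a), m, n)"
      by (metis surj_pair)
    have "(s, m + n, a, m) \<in> ?I" "x = ?e (s, m + n, a, m)"
      using that by (auto simp: x same_block_product_def block_observable_def split: if_splits)
    then show ?thesis
      by blast
  qed
  show ?int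
    by (rule integrable_measure_pmf_finite_support[OF finite_imageI[OF fin] supp])
  have val: "?g (?e p) * pmf (block_stationary signed_label) (?e p) =
      (case p of (s, i, a, m) \<Rightarrow> 1 / 2 * (\<alpha> i a m * \<alpha> i a (m + k)))" if "p \<in> ?I" for p
  proof -
    obtain s i a m where p: "p = (s, i, a, m)"
      by (cases p)
    let ?\<rho> = "(1 / 2) ^ (a + i + 3) :: real"
    from that p have le: "i < N" "a \<le> i" "m + k \<le> i"
      by auto
    then have "?g (?e p) = \<alpha> i a m / sqrt ?\<rho> * (\<alpha> i a (m + k) / sqrt ?\<rho>)"
      by (simp add: p same_block_product_def block_observable_def)
    also have "\<dots> = \<alpha> i a m * \<alpha> i a (m + k) / (sqrt ?\<rho> * sqrt ?\<rho>)"
      by simp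
    also have "sqrt ?\<rho> * sqrt ?\<rho> = ?\<rho>"
      by (rule real_sqrt_mult_self[THEN trans]) simp
    finally have "?g (?e p) = \<alpha> i a m * \<alpha> i a (m + k) / ?\<rho>" .
    moreover have "pmf (block_stationary signed_label) (?e p) = ?\<rho> * (1 / 2)"
      using le by (simp add: p pmf_signed_block_stationary power_add eval_nat_numeral)
    moreover have "?\<rho> \<noteq> 0"
      by simp
    moreover have "X / \<rho> * (\<rho> * (1 / 2)) = 1 / 2 * X" if "\<rho> \<noteq> 0" for X \<rho> :: real
      using that by simp
    ultimately show ?thesis
      unfolding p by (simp only: prod.case not_False_eq_True)
  qed
  have "measure_pmf.expectation (block_stationary signed_label) ?g =
      (\<Sum>x\<in>?e ` ?I. ?g x * pmf (block_stationary signed_label) x)"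
    using supp by (intro integral_measure_pmf_real finite_imageI fin) auto
  also have "\<dots> = (\<Sum>p\<in>?I. ?g (?e p) * pmf (block_stationary signed_label) (?e p))"
    by (rule sum.reindex_cong[OF inj refl]) simp
  also have "\<dots> = (\<Sum>(s, i, a, m)\<in>?I. 1 / 2 * (\<alpha> i a m * \<alpha> i a (m + k)))"
    by (rule sum.cong[OF refl val])
  also have "\<dots> = (\<Sum>s\<in>(UNIV :: bool set). \<Sum>i<N. \<Sum>a\<le>i. \<Sum>m | m + k \<le> i. 1 / 2 * (\<alpha> i a m * \<alpha> i a (m + k)))"
  proof -
    have "finite {m. m + k \<le> i}" for i
      by (rule finite_subset[of _ "{..i}"]) auto
    then have "(\<Sum>i<N. \<Sum>a\<le>i. \<Sum>m | m + k \<le> i. 1 / 2 * (\<alpha> i a m * \<alpha> i a (m + k))) =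
        (\<Sum>(i, a, m)\<in>(SIGMA i:{..<N}. {..i} \<times> {m. m + k \<le> i}). 1 / 2 * (\<alpha> i a m * \<alpha> i a (m + k)))"
      unfolding sum.cartesian_product by (subst sum.Sigma) auto
    then show ?thesis
      by (simp only: sum.cartesian_product)
  qed
  also have "\<dots> = (\<Sum>i<N. \<Sum>a\<le>i. \<Sum>m | m + k \<le> i. \<alpha> i a m * \<alpha> i a (m + k))"
    by (simp add: UNIV_bool sum_divide_distrib[symmetric])
  finally show "measure_pmf.expectation (block_stationary signed_label) ?g =
    (\<Sum>i<N. \<Sum>a\<le>i. \<Sum>m | m + k \<le> i. \<alpha> i a m * \<alpha> i a (m + k))" .
qed

theorem theorem5p1:
  fixes f :: "real \<Rightarrow> real"
  assumes "\<And>x. 0 < f x"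
    and "continuous_on UNIV f"
    and "\<And>x. f (- x) = f x"
    and "\<And>x. f (x + 2 * pi) = f x"
  shows "\<exists>(S :: nat set) (K :: nat \<Rightarrow> nat pmf) (\<pi> :: nat pmf) (h :: nat \<Rightarrow> real).
    markov_kernel S K \<and> irreducible_chain S K \<and> aperiodic_chain S K \<and>
    positive_recurrent_chain S K \<and> stationary_distribution S K \<pi> \<and>
    integrable (measure_pmf \<pi>) (\<lambda>x. (h x)\<^sup>2) \<and> measure_pmf.expectation \<pi> h = 0 \<and>
    (\<forall>k::nat. complex_of_real (\<integral>\<omega>. h (\<omega> 0) * h (\<omega> k) \<partial>path_law \<pi> K) =
       1 / 2 * fourier_coeff f (int k))"
proof -
  obtain \<alpha> where \<alpha>: "\<And>k. (\<lambda>N. of_real (\<Sum>i<N. \<Sum>a\<le>i. \<Sum>m | m + k \<le> i. \<alpha> i a m * \<alpha> i a (m + k)))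
       \<longlonglongrightarrow> 1 / 2 * fourier_coeff f (int k)"
    using fourier_coeff_block_sums[OF assms(1-3)] by blast
  define h where "h = block_observable \<alpha>"
  define flip where "flip = (\<lambda>(s, a :: nat). (\<not> s, a))"
  let ?L = signed_label
  let ?\<pi> = "block_stationary ?L"
  let ?K = "block_kernel ?L"
  let ?G = "same_block_product h"
  let ?cut = "\<lambda>N k x. if fst (snd x) + snd (snd x) < N then ?G k x else 0"
  have cut_lim: "(\<lambda>N. ?cut N k x) \<longlonglongrightarrow> ?G k x" for k x
  proof (rule tendsto_eventually)
    show "\<forall>\<^sub>F N in sequentially. ?cut N k x = ?G k x"
      using eventually_gt_at_top[of "fst (snd x) + snd (snd x)"] by eventually_elim simp
  qed
  have cut_int: "integrable ?\<pi> (?cut N 0)" for N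
    unfolding h_def by (rule block_observable_truncated(1))
  have supp_L: "set_pmf ?L = UNIV"
    by (simp add: signed_label_def set_pmf_geometric set_pmf_bernoulli)
  have flip_L: "map_pmf flip ?L = ?L"
  proof -
    have "map_pmf Not (bernoulli_pmf (1 / 2)) = bernoulli_pmf (1 / 2)"
      unfolding bernoulli_pmf_half_conv_pmf_of_set
      by (rule map_pmf_of_set_bij_betw) (auto simp: bij_betw_def inj_def surj_def)
    moreover have "map_pmf flip ?L = pair_pmf (map_pmf Not (bernoulli_pmf (1 / 2))) geom"
      unfolding signed_label_def pair_map_pmf1 by (intro map_pmf_cong) (auto simp: flip_def)
    ultimately show ?thesis
      by (simp add: signed_label_def)
  qed
  have odd: "h (flip l, m, n) = - h (l, m, n)" for l m n
    by (cases l) (simp add: h_def flip_def block_observable_def)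
  have G0: "?G 0 x = (h x)\<^sup>2" for x
    by (cases x) (simp add: same_block_product_def power2_eq_square)
  \<comment> \<open>At lag \<open>0\<close> the truncated integrands are nonnegative and increasing, and their integrals
    converge to half the mean of \<open>f\<close>; monotone convergence gives the second moment.\<close>
  have sq: "integrable ?\<pi> (\<lambda>x. (h x)\<^sup>2)"
  proof -
    have "(\<lambda>N. measure_pmf.expectation ?\<pi> (?cut N 0)) \<longlonglongrightarrow> Re (1 / 2 * fourier_coeff f (int 0))"
      using tendsto_Re[OF \<alpha>[of 0]] unfolding h_def block_observable_truncated(2) by simp
    moreover have "AE x in ?\<pi>. mono (\<lambda>N. ?cut N 0 x)"
      unfolding mono_def G0 by simp
    moreover have "AE x in ?\<pi>. (\<lambda>N. ?cut N 0 x) \<longlonglongrightarrow> ?G 0 x"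
      by (rule AE_I2) (rule cut_lim)
    moreover have "?G 0 \<in> borel_measurable ?\<pi>"
      by simp
    ultimately have "integrable ?\<pi> (?G 0)"
      by (intro integrable_monotone_convergence[OF cut_int])
    then show ?thesis
      unfolding G0 .
  qed
  note block = flip_L odd sq
  \<comment> \<open>At lag \<open>k\<close> the same-block product is integrable, so the truncation is removed by
    dominated convergence.\<close>
  have cov: "of_real (measure_pmf.expectation (joint_law ?\<pi> ?K k) (\<lambda>(x, y). h x * h y)) = 1 / 2 * fourier_coeff f (int k)" for k
  proof -
    have "(\<lambda>N. measure_pmf.expectation ?\<pi> (?cut N k)) \<longlonglongrightarrow> measure_pmf.expectation ?\<pi> (?G k)"
      by (rule integral_dominated_convergence[where w = "\<lambda>x. norm (?G k x)"])
         (auto intro!: integrable_norm block_autocovariance(1)[OF block] cut_lim)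
    then have "(\<lambda>N. complex_of_real (measure_pmf.expectation ?\<pi> (?cut N k))) \<longlonglongrightarrow> of_real (measure_pmf.expectation ?\<pi> (?G k))"
      by (rule tendsto_of_real)
    from LIMSEQ_unique[OF this[unfolded h_def block_observable_truncated(2), folded h_def] \<alpha>]
    show ?thesis
      unfolding block_autocovariance(2)[OF block] .
  qed
  note chain = recode_chain[OF irreducible_block_chain[OF supp_L] aperiodic_block_chain[OF supp_L]
      block_stationary_invariant set_block_stationary[OF supp_L]]
  let ?\<pi>' = "map_pmf to_nat ?\<pi>" and ?K' = "recode_kernel ?K" and ?h' = "\<lambda>x. h (from_nat x)"
  have "complex_of_real (\<integral>\<omega>. ?h' (\<omega> 0) * ?h' (\<omega> k) \<partial>path_law ?\<pi>' ?K') = 1 / 2 * fourier_coeff f (int k)" for k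
    unfolding integral_path_law_pair[where g = "\<lambda>x y. ?h' x * ?h' y"] chain(6) cov[symmetric]
    by (simp add: case_prod_unfold)
  moreover have "integrable ?\<pi>' (\<lambda>x. (?h' x)\<^sup>2)" "measure_pmf.expectation ?\<pi>' ?h' = 0"
    using sq expectation_block_zero[OF block] by simp_all
  ultimately show ?thesis
    by (intro exI[of _ "range (to_nat :: (bool \<times> nat) \<times> nat \<times> nat \<Rightarrow> nat)"] exI[of _ ?K'] exI[of _ ?\<pi>'] exI[of _ ?h'] conjI allI chain(1-5))
qed

end
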